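(* Let $G$ be a countable discrete group which is not inner amenable, and let $D$ be a separable unital RFD C*-algebra such that $\mathrm{C}^*_{\mathrm{red}}(G)$ is a quotient of $D$, with surjective homomorphism $\theta:D\to\mathrm{C}^*_{\mathrm{red}}(G)$. Let $A$ be the TAF algebra constructed from $D$ by Dădărlat's construction, and let $\rho_\theta$ be the state of $A$ associated to $\theta$ (both described in the context). For any $g\in G$, pick an element $\check g$ of $D$ with norm $1$ which lifts $u_g$ (i.e. $\theta(\check g)=u_g$), and regard $\check g$ as an element of $A$ via the canonical embedding $D\subseteq A$. Then, for any $\varepsilon>0$, there exist $\delta>0$ and a finite set $K\subseteq G$ such that if $u\in A$ is a unitary satisfying $$\|u\check g-\check g u\|_{\rho_\theta}^{\#}<\delta,\quad g\in K,$$ then $$|\rho_\theta(u)|>1-\varepsilon.$$ In particular, since $\|\cdot\|_{\rho_\theta}^{\#}\le\|\cdot\|$, the TAF algebra $A$ does not have Property $\Gamma$ with respect to $\rho_\theta$.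
   Context: Tracially AF (TAF): a unital simple separable C*-algebra $A$ is tracially AF, or TAF, if for any finite set $\mathcal F\subseteq A$, any $\varepsilon>0$, and any $a\in A^+\setminus\{0\}$, there is a non-zero finite-dimensional C*-subalgebra $F\subseteq A$ such that, with $p=1_F$: (1) $\|fp-pf\|<\varepsilon$ for all $f\in\mathcal F$; (2) for each $f\in\mathcal F$, $pfp$ is within $\varepsilon$ of an element of $F$; (3) $1-p$ is Murray-von Neumann equivalent to a projection in $\overline{aAa}$. RFD: a C*-algebra is residually finite-dimensional (RFD) if it has a separating family of finite-dimensional representations. Inner amenability: a mean on a countable discrete group $G$ is a positive linear functional $m$ on $l^\infty(G)$ with $m(1)=1$; the trivial mean is $d_e(f)=f(e)$, where $e$ is the neutral element. For a function $\xi$ on $G$ and $g\in G$ put $(g\xi g^{-1})(x)=\xi(g^{-1}xg)$. $G$ is inner amenable if there is a nontrivial mean $m$ (i.e. $m\neq d_e$) with $m(g\xi g^{-1})=m(\xi)$ for all $\xi\in l^\infty(G)$, $g\in G$. $\mathrm{C}^*_{\mathrm{red}}(G)$ is the reduced group C*-algebra, $u_g$ ($g\in G$) its standard unitaries, and $\tau$ its canonical tracial state, extending $a\mapsto a(e)$ on $\mathbb C[G]$. Dădărlat's construction: let $\pi_1,\pi_2,\dots$ be a sequence of finite-dimensional representations of $D$ which separates points, of dimensions $n_1,n_2,\dots$. Let $k_1=1$ and $k_i=(n_1+1)\cdots(n_{i-1}+1)$ for $i\ge 2$. Then $A$ is the direct limit of the algebras $\mathrm{M}_{k_i}(D)$ with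 connecting maps $\mathrm{M}_{k_i}(D)\to \mathrm{M}_{k_{i+1}}(D)$, $a\mapsto \mathrm{diag}(a,\pi_i(a))$, where $\pi_i$ is applied entrywise and the scalar matrix $\pi_i(a)$ is regarded as an element of $\mathrm{M}_{k_in_i}(\mathbb C 1_D)\subseteq \mathrm{M}_{k_in_i}(D)$. The algebra $A$ is a simple unital separable TAF algebra. The composed maps $D=\mathrm{M}_{k_1}(D)\to \mathrm{M}_{k_i}(D)$ have the form $a\mapsto\mathrm{diag}(a,\pi(a))$ with $\pi:D\to \mathrm{M}_{k_i-1}(\mathbb C1_D)$ a finite-dimensional representation; they induce the embedding by which $D$ is regarded as a sub-C*-algebra of $A$. The state $\rho_\theta$ of $A$ is determined by $\rho_\theta((a_{jk}))=\tau(\theta(a_{11}))$ for $(a_{jk})\in \mathrm{M}_{k_i}(D)$. For $a\in A$, $\|a\|_{\rho_\theta}^{\#}=\left(\frac{\rho_\theta(aa^* )+\rho_\theta(a^*a)}{2}\right)^{1/2}$. Property $\Gamma$: a unital C*-algebra $A$ has Property $\Gamma$ with respect to a state $\rho$ if there is a central sequence of unitaries $(u_i)$ of $A$ (i.e. $\|u_ia-au_i\|\to0$ for all $a\in A$) such that $|\rho(u_i)|\to 0$ as $i\to\infty$.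
   Formalization: The formal theorem assumes in addition that G is not the trivial group; the trivial group is not inner amenable under the given definition, and for it the claim fails (D = C, all n_i = 1, A the CAR algebra, u a flip unitary with rho_theta(u) = 0). *)

theory Defs
  imports "HOL-Analysis.Analysis" "HOL-Algebra.Group" "Jordan_Normal_Form.Matrix"
begin

hide_const (open) Finite_Cartesian_Product.vec Finite_Cartesian_Product.mat
no_notation Inner_Product.real_inner_class.inner (infix \<open>\<bullet>\<close> 70)
no_notation Finite_Cartesian_Product.vec_nth (infixl \<open>$\<close> 90)

section \<open>Unital C*-algebras\<close>

text \<open>
  A type of this class is a nonzero unital C*-algebra. The class \<open>real_normed_algebra_1\<close> supplies
  the submultiplicative norm, \<open>norm 1 = 1\<close> and the underlying real algebra; \<open>banach\<close> supplies
  completeness.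
\<close>

class cstar_algebra = banach + real_normed_algebra_1 +
  fixes scaleC :: "complex \<Rightarrow> 'a \<Rightarrow> 'a" (infixr \<open>*\<^sub>C\<close> 75)
    and star :: "'a \<Rightarrow> 'a"
  assumes scaleC_add_right: "c *\<^sub>C (x + y) = c *\<^sub>C x + c *\<^sub>C y"
    and scaleC_add_left: "(c + d) *\<^sub>C x = c *\<^sub>C x + d *\<^sub>C x"
    and scaleC_scaleC: "c *\<^sub>C (d *\<^sub>C x) = (c * d) *\<^sub>C x"
    and scaleC_of_real: "complex_of_real r *\<^sub>C x = r *\<^sub>R x"
    and mult_scaleC_left: "(c *\<^sub>C x) * y = c *\<^sub>C (x * y)"
    and mult_scaleC_right: "x * (c *\<^sub>C y) = c *\<^sub>C (x * y)"
    and norm_scaleC: "norm (c *\<^sub>C x) = cmod c * norm x"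
    and star_add: "star (x + y) = star x + star y"
    and star_scaleC: "star (c *\<^sub>C x) = cnj c *\<^sub>C star x"
    and star_mult: "star (x * y) = star y * star x"
    and star_star: "star (star x) = x"
    and cstar_identity: "norm (star x * x) = (norm x)\<^sup>2"

instantiation complex :: cstar_algebra
begin

definition scaleC_complex :: "complex \<Rightarrow> complex \<Rightarrow> complex" where
  "scaleC_complex c x = c * x"

definition star_complex :: "complex \<Rightarrow> complex" where
  "star_complex x = cnj x"

instance
  by standard
    (simp_all add: scaleC_complex_def star_complex_def algebra_simps norm_mult
      power2_eq_square scaleR_conv_of_real)

end

definition is_unitary :: "'a::cstar_algebra \<Rightarrow> bool" where
  "is_unitary u \<longleftrightarrow> star u * u = 1 \<and> u * star u = 1"

definition separable_algebra :: "'a::cstar_algebra itself \<Rightarrow> bool" where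
  "separable_algebra _ \<longleftrightarrow> (\<exists>S :: 'a set. countable S \<and> closure S = UNIV)"

text \<open>A positive linear functional of norm one; in the unital case the norm is attained at \<open>1\<close>.\<close>

definition is_state :: "('a::cstar_algebra \<Rightarrow> complex) \<Rightarrow> bool" where
  "is_state \<rho> \<longleftrightarrow>
     (\<forall>a b. \<rho> (a + b) = \<rho> a + \<rho> b) \<and>
     (\<forall>c a. \<rho> (c *\<^sub>C a) = c * \<rho> a) \<and>
     (\<forall>a. \<rho> (star a * a) \<in> \<real>\<^sub>\<ge>\<^sub>0) \<and>
     (\<forall>a. cmod (\<rho> a) \<le> norm a) \<and> \<rho> 1 = 1"

definition sharp_norm :: "('a::cstar_algebra \<Rightarrow> complex) \<Rightarrow> 'a \<Rightarrow> real" where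
  "sharp_norm \<rho> a = sqrt (Re (\<rho> (a * star a) + \<rho> (star a * a)) / 2)"

definition property_Gamma :: "('a::cstar_algebra \<Rightarrow> complex) \<Rightarrow> bool" where
  "property_Gamma \<rho> \<longleftrightarrow>
     (\<exists>u :: nat \<Rightarrow> 'a. (\<forall>i. is_unitary (u i)) \<and>
        (\<forall>a. (\<lambda>i. norm (u i * a - a * u i)) \<longlonglongrightarrow> 0) \<and>
        (\<lambda>i. cmod (\<rho> (u i))) \<longlonglongrightarrow> 0)"


section \<open>Matrices over a C*-algebra\<close>

definition mat_star :: "'a::cstar_algebra mat \<Rightarrow> 'a mat" where
  "mat_star A = transpose_mat (map_mat star A)"

text \<open>
  The C*-norm of \<open>M\<^sub>k(D)\<close>: it is the operator norm for the action of \<open>M\<^sub>k(D)\<close> by left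
  multiplication on the Hilbert \<open>D\<close>-module \<open>D\<^sup>k\<close>, whose norm is \<open>\<parallel>v\<parallel> = \<parallel>\<Sum>\<^sub>i v\<^sub>i\<^sup>* v\<^sub>i\<parallel>\<^bsup>1/2\<^esup>\<close>.
\<close>

definition module_norm :: "'a::cstar_algebra vec \<Rightarrow> real" where
  "module_norm v = sqrt (norm (\<Sum>i<dim_vec v. star (v $ i) * (v $ i)))"

definition mat_norm :: "'a::cstar_algebra mat \<Rightarrow> real" where
  "mat_norm A = (SUP v \<in> {v \<in> carrier_vec (dim_col A). module_norm v \<le> 1}. module_norm (A *\<^sub>v v))"

text \<open>Unital *-homomorphisms \<open>M\<^sub>k(D) \<rightarrow> A\<close>.\<close>

definition mat_star_hom :: "nat \<Rightarrow> ('d::cstar_algebra mat \<Rightarrow> 'a::cstar_algebra) \<Rightarrow> bool" where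
  "mat_star_hom k \<phi> \<longleftrightarrow>
     (\<forall>a \<in> carrier_mat k k. \<forall>b \<in> carrier_mat k k. \<phi> (a + b) = \<phi> a + \<phi> b \<and> \<phi> (a * b) = \<phi> a * \<phi> b) \<and>
     (\<forall>c. \<forall>a \<in> carrier_mat k k. \<phi> (map_mat (scaleC c) a) = c *\<^sub>C \<phi> a) \<and>
     (\<forall>a \<in> carrier_mat k k. \<phi> (mat_star a) = star (\<phi> a)) \<and>
     \<phi> (1\<^sub>m k) = 1"

text \<open>Representations of the unital algebra \<open>D\<close> on \<open>\<complex>\<^sup>n\<close> are taken to be unital, with \<open>n > 0\<close>.\<close>

definition fin_dim_rep :: "nat \<Rightarrow> ('d::cstar_algebra \<Rightarrow> complex mat) \<Rightarrow> bool" where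
  "fin_dim_rep n \<pi> \<longleftrightarrow> 0 < n \<and>
     (\<forall>a. \<pi> a \<in> carrier_mat n n) \<and>
     (\<forall>a b. \<pi> (a + b) = \<pi> a + \<pi> b) \<and>
     (\<forall>c a. \<pi> (c *\<^sub>C a) = c \<cdot>\<^sub>m \<pi> a) \<and>
     (\<forall>a b. \<pi> (a * b) = \<pi> a * \<pi> b) \<and>
     (\<forall>a. \<pi> (star a) = mat_star (\<pi> a)) \<and>
     \<pi> 1 = 1\<^sub>m n"

definition RFD :: "'d::cstar_algebra itself \<Rightarrow> bool" where
  "RFD _ \<longleftrightarrow> (\<forall>a :: 'd. a \<noteq> 0 \<longrightarrow> (\<exists>n \<pi>. fin_dim_rep n \<pi> \<and> \<pi> a \<noteq> 0\<^sub>m n n))"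


section \<open>Direct limits of matrix algebras and Dadarlat's construction\<close>

text \<open>The composite of \<open>\<phi> i, \<dots>, \<phi> (i + j - 1)\<close>.\<close>

primrec connecting :: "(nat \<Rightarrow> 'd mat \<Rightarrow> 'd mat) \<Rightarrow> nat \<Rightarrow> nat \<Rightarrow> 'd mat \<Rightarrow> 'd mat" where
  "connecting \<phi> i 0 a = a"
| "connecting \<phi> i (Suc j) a = \<phi> (i + j) (connecting \<phi> i j a)"

text \<open>
  \<open>(A, \<mu>)\<close> is the C*-algebra direct limit of \<open>M\<^bsub>k 0\<^esub>(D) \<rightarrow> M\<^bsub>k 1\<^esub>(D) \<rightarrow> \<dots>\<close> with unital
  connecting maps \<open>\<phi> i\<close>, i.e. the completion of the algebraic direct limit in the seminorm
  \<open>lim\<^sub>j \<parallel>\<phi>\<^bsub>i,j\<^esub>(a)\<parallel>\<close>. This determines \<open>(A, \<mu>)\<close> up to a unique isomorphism.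
\<close>

definition cstar_direct_limit ::
  "(nat \<Rightarrow> nat) \<Rightarrow> (nat \<Rightarrow> 'd::cstar_algebra mat \<Rightarrow> 'd mat) \<Rightarrow> (nat \<Rightarrow> 'd mat \<Rightarrow> 'a::cstar_algebra) \<Rightarrow> bool"
  where
  "cstar_direct_limit k \<phi> \<mu> \<longleftrightarrow>
     (\<forall>i. mat_star_hom (k i) (\<mu> i)) \<and>
     (\<forall>i. \<forall>a \<in> carrier_mat (k i) (k i). \<mu> (Suc i) (\<phi> i a) = \<mu> i a) \<and>
     (\<forall>i. \<forall>a \<in> carrier_mat (k i) (k i). (\<lambda>j. mat_norm (connecting \<phi> i j a)) \<longlonglongrightarrow> norm (\<mu> i a)) \<and>
     closure (\<Union>i. \<mu> i ` carrier_mat (k i) (k i)) = UNIV"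

text \<open>Indices start at \<open>0\<close>: the sequences \<open>n\<close>, \<open>\<pi>\<close>, \<open>k\<close> and \<open>\<mu>\<close> are shifted by one.\<close>

definition dad_size :: "(nat \<Rightarrow> nat) \<Rightarrow> nat \<Rightarrow> nat" where
  "dad_size n i = (\<Prod>j<i. n j + 1)"

text \<open>
  \<open>\<pi>\<close> applied entrywise to a \<open>k \<times> k\<close> matrix over \<open>D\<close>; the resulting \<open>k \<times> k\<close> matrix of
  \<open>n \<times> n\<close> blocks of scalars is read as a matrix with entries in \<open>\<complex> 1\<^sub>D\<close>.
\<close>

definition entrywise_rep ::
  "nat \<Rightarrow> nat \<Rightarrow> ('d::cstar_algebra \<Rightarrow> complex mat) \<Rightarrow> 'd mat \<Rightarrow> 'd mat" where
  "entrywise_rep k n \<pi> a =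
     mat (k * n) (k * n)
       (\<lambda>(r, s). (\<pi> (a $$ (r div n, s div n)) $$ (r mod n, s mod n)) *\<^sub>C 1)"

definition dad_map ::
  "(nat \<Rightarrow> nat) \<Rightarrow> (nat \<Rightarrow> 'd::cstar_algebra \<Rightarrow> complex mat) \<Rightarrow> nat \<Rightarrow> 'd mat \<Rightarrow> 'd mat" where
  "dad_map n \<pi> i a =
     (let k = dad_size n i; m = k * n i
      in four_block_mat a (0\<^sub>m k m) (0\<^sub>m m k) (entrywise_rep k (n i) (\<pi> i) a))"

definition dadarlat_limit ::
  "(nat \<Rightarrow> nat) \<Rightarrow> (nat \<Rightarrow> 'd::cstar_algebra \<Rightarrow> complex mat) \<Rightarrow> (nat \<Rightarrow> 'd mat \<Rightarrow> 'a::cstar_algebra) \<Rightarrow> bool"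
  where
  "dadarlat_limit n \<pi> \<mu> \<longleftrightarrow>
     (\<forall>i. fin_dim_rep (n i) (\<pi> i)) \<and>
     (\<forall>a. a \<noteq> 0 \<longrightarrow> (\<exists>i. \<pi> i a \<noteq> 0\<^sub>m (n i) (n i))) \<and>
     cstar_direct_limit (dad_size n) (dad_map n \<pi>) \<mu>"

text \<open>The canonical embedding \<open>D = M\<^sub>1(D) \<rightarrow> A\<close>.\<close>

definition dad_embed :: "(nat \<Rightarrow> 'd::cstar_algebra mat \<Rightarrow> 'a::cstar_algebra) \<Rightarrow> 'd \<Rightarrow> 'a" where
  "dad_embed \<mu> d = \<mu> 0 (mat 1 1 (\<lambda>_. d))"


section \<open>Inner amenability\<close>

text \<open>Functions on \<open>G\<close> are represented by functions that vanish off \<open>carrier G\<close>.\<close>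

definition linf :: "('g, 'b) monoid_scheme \<Rightarrow> ('g \<Rightarrow> complex) set" where
  "linf G = {\<xi>. bounded (\<xi> ` carrier G) \<and> (\<forall>x. x \<notin> carrier G \<longrightarrow> \<xi> x = 0)}"

definition is_mean :: "('g, 'b) monoid_scheme \<Rightarrow> (('g \<Rightarrow> complex) \<Rightarrow> complex) \<Rightarrow> bool" where
  "is_mean G m \<longleftrightarrow>
     (\<forall>\<xi> \<in> linf G. \<forall>\<eta> \<in> linf G. m (\<lambda>x. \<xi> x + \<eta> x) = m \<xi> + m \<eta>) \<and>
     (\<forall>c. \<forall>\<xi> \<in> linf G. m (\<lambda>x. c * \<xi> x) = c * m \<xi>) \<and>
     (\<forall>\<xi> \<in> linf G. (\<forall>x \<in> carrier G. \<xi> x \<in> \<real>\<^sub>\<ge>\<^sub>0) \<longrightarrow> m \<xi> \<in> \<real>\<^sub>\<ge>\<^sub>0) \<and>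
     m (\<lambda>x. if x \<in> carrier G then 1 else 0) = 1"

definition conj_fun :: "('g, 'b) monoid_scheme \<Rightarrow> 'g \<Rightarrow> ('g \<Rightarrow> complex) \<Rightarrow> 'g \<Rightarrow> complex" where
  "conj_fun G g \<xi> = (\<lambda>x. if x \<in> carrier G then \<xi> (inv\<^bsub>G\<^esub> g \<otimes>\<^bsub>G\<^esub> x \<otimes>\<^bsub>G\<^esub> g) else 0)"

text \<open>
  For the trivial group \<open>d\<^sub>e\<close> is the only mean, so it is not inner amenable in this sense; it has
  to be excluded separately where that matters.
\<close>

definition inner_amenable :: "('g, 'b) monoid_scheme \<Rightarrow> bool" where
  "inner_amenable G \<longleftrightarrow>
     (\<exists>m. is_mean G m \<and> (\<exists>\<xi> \<in> linf G. m \<xi> \<noteq> \<xi> \<one>\<^bsub>G\<^esub>) \<and>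
        (\<forall>\<xi> \<in> linf G. \<forall>g \<in> carrier G. m (conj_fun G g \<xi>) = m \<xi>))"


section \<open>The reduced group C*-algebra\<close>

definition ell2 :: "('g, 'b) monoid_scheme \<Rightarrow> ('g \<Rightarrow> complex) set" where
  "ell2 G = {\<xi>. (\<lambda>x. (cmod (\<xi> x))\<^sup>2) summable_on carrier G \<and> (\<forall>x. x \<notin> carrier G \<longrightarrow> \<xi> x = 0)}"

definition ell2_inner :: "('g, 'b) monoid_scheme \<Rightarrow> ('g \<Rightarrow> complex) \<Rightarrow> ('g \<Rightarrow> complex) \<Rightarrow> complex" where
  "ell2_inner G \<xi> \<eta> = (\<Sum>\<^sub>\<infinity>x\<in>carrier G. \<xi> x * cnj (\<eta> x))"

definition ell2_norm :: "('g, 'b) monoid_scheme \<Rightarrow> ('g \<Rightarrow> complex) \<Rightarrow> real" where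
  "ell2_norm G \<xi> = sqrt (\<Sum>\<^sub>\<infinity>x\<in>carrier G. (cmod (\<xi> x))\<^sup>2)"

text \<open>
  Operators on \<open>\<ell>\<^sup>2(G)\<close> are functions that send everything outside \<open>\<ell>\<^sup>2(G)\<close> to \<open>0\<close>, so that
  equality of operators is equality of functions.
\<close>

type_synonym 'g op = "('g \<Rightarrow> complex) \<Rightarrow> ('g \<Rightarrow> complex)"

definition bounded_op :: "('g, 'b) monoid_scheme \<Rightarrow> 'g op \<Rightarrow> bool" where
  "bounded_op G T \<longleftrightarrow>
     (\<forall>\<xi> \<in> ell2 G. T \<xi> \<in> ell2 G) \<and>
     (\<forall>\<xi>. \<xi> \<notin> ell2 G \<longrightarrow> T \<xi> = (\<lambda>_. 0)) \<and>
     (\<forall>\<xi> \<in> ell2 G. \<forall>\<eta> \<in> ell2 G. T (\<lambda>x. \<xi> x + \<eta> x) = (\<lambda>x. T \<xi> x + T \<eta> x)) \<and>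
     (\<forall>c. \<forall>\<xi> \<in> ell2 G. T (\<lambda>x. c * \<xi> x) = (\<lambda>x. c * T \<xi> x)) \<and>
     (\<exists>C. \<forall>\<xi> \<in> ell2 G. ell2_norm G (T \<xi>) \<le> C * ell2_norm G \<xi>)"

text \<open>The standard unitary \<open>u\<^sub>g\<close>: left translation by \<open>g\<close>.\<close>

definition left_reg :: "('g, 'b) monoid_scheme \<Rightarrow> 'g \<Rightarrow> 'g op" where
  "left_reg G g = (\<lambda>\<xi> x. if \<xi> \<in> ell2 G \<and> x \<in> carrier G then \<xi> (inv\<^bsub>G\<^esub> g \<otimes>\<^bsub>G\<^esub> x) else 0)"

definition group_algebra_ops :: "('g, 'b) monoid_scheme \<Rightarrow> 'g op set" where
  "group_algebra_ops G =
     {\<lambda>\<xi> x. \<Sum>g\<in>F. c g * left_reg G g \<xi> x | F c. finite F \<and> F \<subseteq> carrier G}"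

text \<open>The closure of the group algebra in the operator norm.\<close>

definition reduced_cstar :: "('g, 'b) monoid_scheme \<Rightarrow> 'g op set" where
  "reduced_cstar G =
     {T. bounded_op G T \<and>
        (\<forall>\<epsilon>>0. \<exists>S \<in> group_algebra_ops G. \<forall>\<xi> \<in> ell2 G.
           ell2_norm G (\<lambda>x. T \<xi> x - S \<xi> x) \<le> \<epsilon> * ell2_norm G \<xi>)}"

text \<open>The vector state \<open>T \<mapsto> \<langle>T \<delta>\<^sub>e, \<delta>\<^sub>e\<rangle>\<close>; on the group algebra it is \<open>a \<mapsto> a(e)\<close>.\<close>

definition canonical_trace :: "('g, 'b) monoid_scheme \<Rightarrow> 'g op \<Rightarrow> complex" where
  "canonical_trace G T =
     (let \<delta> = (\<lambda>x. if x = \<one>\<^bsub>G\<^esub> then 1 else 0) in ell2_inner G (T \<delta>) \<delta>)"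

text \<open>
  Surjective *-homomorphisms from \<open>D\<close> onto the reduced group C*-algebra; the last clause says
  that \<open>\<theta> (star a)\<close> is the Hilbert space adjoint of \<open>\<theta> a\<close>.
\<close>

definition surj_star_hom_reduced ::
  "('g, 'b) monoid_scheme \<Rightarrow> ('d::cstar_algebra \<Rightarrow> 'g op) \<Rightarrow> bool" where
  "surj_star_hom_reduced G \<theta> \<longleftrightarrow>
     range \<theta> = reduced_cstar G \<and>
     (\<forall>a b. \<theta> (a + b) = (\<lambda>\<xi> x. \<theta> a \<xi> x + \<theta> b \<xi> x)) \<and>
     (\<forall>c a. \<theta> (c *\<^sub>C a) = (\<lambda>\<xi> x. c * \<theta> a \<xi> x)) \<and>
     (\<forall>a b. \<theta> (a * b) = \<theta> a \<circ> \<theta> b) \<and>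
     (\<forall>a. \<forall>\<xi> \<in> ell2 G. \<forall>\<eta> \<in> ell2 G.
        ell2_inner G (\<theta> a \<xi>) \<eta> = ell2_inner G \<xi> (\<theta> (star a) \<eta>))"

text \<open>
  The state of \<open>A\<close> given by \<open>(a\<^sub>j\<^sub>k) \<mapsto> \<tau>(\<theta>(a\<^sub>1\<^sub>1))\<close> on each \<open>M\<^bsub>k i\<^esub>(D)\<close>; it is unique because
  the images of these algebras are dense in \<open>A\<close>.
\<close>

definition is_rho_theta ::
  "('g, 'b) monoid_scheme \<Rightarrow> ('d::cstar_algebra \<Rightarrow> 'g op) \<Rightarrow> (nat \<Rightarrow> nat) \<Rightarrow>
   (nat \<Rightarrow> 'd mat \<Rightarrow> 'a::cstar_algebra) \<Rightarrow> ('a \<Rightarrow> complex) \<Rightarrow> bool" where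
  "is_rho_theta G \<theta> n \<mu> \<rho> \<longleftrightarrow>
     is_state \<rho> \<and>
     (\<forall>i. \<forall>a \<in> carrier_mat (dad_size n i) (dad_size n i).
        \<rho> (\<mu> i a) = canonical_trace G (\<theta> (a $$ (0, 0))))"

end

theory Submission
  imports Defs
begin

text \<open>
  Let \<open>V\<^sub>j = \<theta>(a\<^sub>j\<^sub>1) \<delta>\<^sub>e \<in> \<ell>\<^sup>2(G)\<close> be the vectors given by the first column of \<open>a \<in> M\<^sub>k(D)\<close>. The state satisfies
  \<open>\<rho>(a\<^sup>* a) = \<Sum>\<^sub>j \<parallel>V\<^sub>j\<parallel>\<^sup>2\<close> and \<open>\<rho>(a) = V\<^sub>1(e)\<close>, and the lift of \<open>u\<^sub>g\<close> acts as \<open>diag(u\<^sub>g, \<sigma>)\<close> with a scalar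
  contraction \<open>\<sigma>\<close>. If \<open>a\<close> almost commutes with the lift, the density \<open>\<bar>V\<^sub>1\<bar>\<^sup>2\<close> is almost invariant under
  conjugation by \<open>g\<close>, and the density \<open>\<Sum>\<^sub>j\<^sub>>\<^sub>1 \<bar>V\<^sub>j\<bar>\<^sup>2\<close> almost invariant under right translation by \<open>g\<close>. As
  \<open>G\<close> is not inner amenable (hence not amenable, being nontrivial), the former must be small off \<open>e\<close> and
  the latter small altogether, so \<open>\<rho>(a\<^sup>* a)\<close> is close to \<open>\<bar>\<rho>(a)\<bar>\<^sup>2\<close>. By density this holds for \<open>a = u\<close>.
\<close>

section \<open>Invariant means from almost invariant densities\<close>

text \<open>A lift of \<open>u_g\<close> has norm one but need not be unitary, and its scalar block
  is only known to be a contraction. So the vectors with index above 1 satisfy only an inequality: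
  their density translated by \<open>g\<close> is at most the density itself, up to an error. This
  suffices because a translation preserves the total mass, and it holds at each group element
  separately because the scalars mix the indices and leave the group variable alone. Working with
  densities rather than vectors also lets conjugation and translation share one dichotomy: either
  almost invariant probability densities cluster at an invariant mean, or finitely many group
  elements already bound the mass of every density by its increments. That bound is homogeneous, so
  the columns of an arbitrary matrix need no normalisation. The resulting estimate is stated for
  arbitrary elements, since a unitary of \<open>A\<close> is a limit of matrices that need not be
  unitary.\<close>

lemma infsum_minus:
  fixes f g :: "'x \<Rightarrow> 'b::{topological_ab_group_add, t2_space}"
  assumes "f summable_on X" "g summable_on X"
  shows "(\<lambda>x. f x - g x) summable_on X"
    and "(\<Sum>\<^sub>\<infinity>x\<in>X. f x - g x) = (\<Sum>\<^sub>\<infinity>x\<in>X. f x) - (\<Sum>\<^sub>\<infinity>x\<in>X. g x)"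
proof -
  have "((\<lambda>x. f x + - g x) has_sum (\<Sum>\<^sub>\<infinity>x\<in>X. f x) + - (\<Sum>\<^sub>\<infinity>x\<in>X. g x)) X"
    using assms by (intro has_sum_add) (simp_all add: has_sum_uminus)
  then show "(\<lambda>x. f x - g x) summable_on X"
    and "(\<Sum>\<^sub>\<infinity>x\<in>X. f x - g x) = (\<Sum>\<^sub>\<infinity>x\<in>X. f x) - (\<Sum>\<^sub>\<infinity>x\<in>X. g x)"
    by (simp_all add: has_sum_iff)
qed

text \<open>The functional is total, with conditions only where functions are bounded on
  \<open>X\<close>. Each clause restricts finitely many values of \<open>m\<close> by closed
  conditions, which makes means stable under pointwise limits. Since \<open>B\<close> may be
  negative, there is no mean on the empty set.\<close>

definition mean_on :: "'x set \<Rightarrow> (('x \<Rightarrow> complex) \<Rightarrow> complex) \<Rightarrow> bool" where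
  "mean_on X m \<longleftrightarrow>
     (\<forall>\<phi> \<psi>. bounded (\<phi> ` X) \<longrightarrow> bounded (\<psi> ` X) \<longrightarrow> m (\<lambda>x. \<phi> x + \<psi> x) = m \<phi> + m \<psi>) \<and>
     (\<forall>c \<phi>. bounded (\<phi> ` X) \<longrightarrow> m (\<lambda>x. c * \<phi> x) = c * m \<phi>) \<and>
     (\<forall>\<phi> B. (\<forall>x\<in>X. cmod (\<phi> x) \<le> B) \<longrightarrow> cmod (m \<phi>) \<le> B) \<and>
     (\<forall>\<phi>. bounded (\<phi> ` X) \<longrightarrow> (\<forall>x\<in>X. \<phi> x \<in> \<real>\<^sub>\<ge>\<^sub>0) \<longrightarrow> m \<phi> \<in> \<real>\<^sub>\<ge>\<^sub>0) \<and>
     m (\<lambda>_. 1) = 1"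

lemma mean_onD:
  assumes "mean_on X m"
  shows "bounded (\<phi> ` X) \<Longrightarrow> bounded (\<psi> ` X) \<Longrightarrow> m (\<lambda>x. \<phi> x + \<psi> x) = m \<phi> + m \<psi>"
    and "bounded (\<phi> ` X) \<Longrightarrow> m (\<lambda>x. c * \<phi> x) = c * m \<phi>"
    and "\<forall>x\<in>X. cmod (\<phi> x) \<le> B \<Longrightarrow> cmod (m \<phi>) \<le> B"
    and "bounded (\<phi> ` X) \<Longrightarrow> \<forall>x\<in>X. \<phi> x \<in> \<real>\<^sub>\<ge>\<^sub>0 \<Longrightarrow> m \<phi> \<in> \<real>\<^sub>\<ge>\<^sub>0"
    and "m (\<lambda>_. 1) = 1"
  using assms unfolding mean_on_def by blast+

lemma bounded_fun_plus:
  fixes \<phi> \<psi> :: "'x \<Rightarrow> complex"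
  assumes "bounded (\<phi> ` X)" "bounded (\<psi> ` X)"
  shows "bounded ((\<lambda>x. \<phi> x + \<psi> x) ` X)"
proof -
  obtain a b where "\<forall>x\<in>X. cmod (\<phi> x) \<le> a" "\<forall>x\<in>X. cmod (\<psi> x) \<le> b"
    using assms by (auto simp: bounded_iff)
  then have "\<forall>x\<in>X. cmod (\<phi> x + \<psi> x) \<le> a + b"
    by (meson add_mono norm_triangle_le)
  then show ?thesis by (auto simp: bounded_iff)
qed

lemma bounded_fun_cmult:
  fixes \<phi> :: "'x \<Rightarrow> complex"
  assumes "bounded (\<phi> ` X)"
  shows "bounded ((\<lambda>x. c * \<phi> x) ` X)"
proof -
  obtain a where "\<forall>x\<in>X. cmod (\<phi> x) \<le> a"
    using assms by (auto simp: bounded_iff)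
  then have "\<forall>x\<in>X. cmod (c * \<phi> x) \<le> cmod c * a"
    by (simp add: norm_mult mult_left_mono)
  then show ?thesis by (auto simp: bounded_iff)
qed

text \<open>The difference vanishes on \<open>X\<close>, so the norm clause with bound 0 annihilates
  it.\<close>

lemma mean_on_cong:
  assumes m: "mean_on X m" and b: "bounded (\<phi> ` X)" and eq: "\<And>x. x \<in> X \<Longrightarrow> \<phi> x = \<psi> x"
  shows "m \<phi> = m \<psi>"
proof -
  have b': "bounded (\<psi> ` X)"
    using b eq by (metis image_cong)
  have "m (\<lambda>x. \<phi> x + (-1) * \<psi> x) = m \<phi> + (-1) * m \<psi>"
    using mean_onD(1)[OF m b bounded_fun_cmult[OF b', of "-1"]] mean_onD(2)[OF m b', of "-1"] by simp
  moreover have "cmod (m (\<lambda>x. \<phi> x + (-1) * \<psi> x)) \<le> 0"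
  proof -
    have "\<forall>x\<in>X. cmod (\<phi> x + (-1) * \<psi> x) \<le> 0"
      using eq by simp
    then show ?thesis by (rule mean_onD(3)[OF m])
  qed
  ultimately show ?thesis by simp
qed

section \<open>Compactness in the topology of pointwise convergence\<close>

lemma cluster_point_in_closed:
  fixes x :: "'a::topological_space"
  assumes "inf (nhds x) F \<noteq> bot" "closed C" "eventually (\<lambda>y. y \<in> C) F"
  shows "x \<in> C"
proof (rule ccontr)
  assume "x \<notin> C"
  then have "eventually (\<lambda>y. y \<in> - C) (nhds x)"
    using assms(2) by (intro eventually_nhds_in_open) auto
  with assms(3) have "eventually (\<lambda>y. False) (inf (nhds x) F)"
    unfolding eventually_inf by (metis ComplD)
  then show False using assms(1) by (simp add: trivial_limit_def)
qed

text \<open>Tychonoff for a product of closed discs. Linearity is not imposed here; it is recovered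
  later as a closed condition.\<close>

lemma compact_pointwise_bounded:
  fixes b :: "'f \<Rightarrow> real"
  shows "compact {m :: 'f \<Rightarrow> complex. \<forall>\<phi>. cmod (m \<phi>) \<le> b \<phi>}"
proof -
  have "compactin (product_topology (\<lambda>_. euclidean) UNIV) (PiE UNIV (\<lambda>\<phi>. cball (0::complex) (b \<phi>)))"
    by (simp add: compactin_PiE)
  moreover have "PiE UNIV (\<lambda>\<phi>. cball (0::complex) (b \<phi>)) = {m. \<forall>\<phi>. cmod (m \<phi>) \<le> b \<phi>}"
    by (auto simp: PiE_def)
  ultimately show ?thesis
    by (simp add: euclidean_product_topology)
qed

section \<open>Means given by probability densities\<close>

lemma abs_summable_density:
  fixes p :: "'x \<Rightarrow> real" and \<phi> :: "'x \<Rightarrow> complex"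
  assumes p: "\<And>x. x \<in> X \<Longrightarrow> 0 \<le> p x" "p summable_on X" and B: "\<And>x. x \<in> X \<Longrightarrow> cmod (\<phi> x) \<le> B"
  shows "(\<lambda>x. of_real (p x) * \<phi> x) summable_on X"
    and "cmod (\<Sum>\<^sub>\<infinity>x\<in>X. of_real (p x) * \<phi> x) \<le> B * (\<Sum>\<^sub>\<infinity>x\<in>X. p x)"
proof -
  have le: "cmod (of_real (p x) * \<phi> x) \<le> B * p x" if "x \<in> X" for x
    using p(1)[OF that] B[OF that] by (simp add: norm_mult mult.commute[of B] mult_left_mono)
  have s: "(\<lambda>x. B * p x) summable_on X"
    using p(2) by (rule summable_on_cmult_right)
  have a: "(\<lambda>x. cmod (of_real (p x) * \<phi> x)) summable_on X"
    by (rule summable_on_comparison_test[OF s]) (use le in auto)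
  then show "(\<lambda>x. of_real (p x) * \<phi> x) summable_on X"
    by (rule abs_summable_summable)
  have "cmod (\<Sum>\<^sub>\<infinity>x\<in>X. of_real (p x) * \<phi> x) \<le> (\<Sum>\<^sub>\<infinity>x\<in>X. cmod (of_real (p x) * \<phi> x))"
    by (rule norm_infsum_bound[OF a])
  also have "\<dots> \<le> (\<Sum>\<^sub>\<infinity>x\<in>X. B * p x)"
    by (rule infsum_mono[OF a s le])
  also have "\<dots> = B * (\<Sum>\<^sub>\<infinity>x\<in>X. p x)"
    by (rule infsum_cmult_right) (use p in auto)
  finally show "cmod (\<Sum>\<^sub>\<infinity>x\<in>X. of_real (p x) * \<phi> x) \<le> B * (\<Sum>\<^sub>\<infinity>x\<in>X. p x)" .
qed

text \<open>Off the bounded functions the functional is set to zero, so that all of them lie in one compact product.\<close>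

definition density_mean :: "'x set \<Rightarrow> ('x \<Rightarrow> real) \<Rightarrow> ('x \<Rightarrow> complex) \<Rightarrow> complex" where
  "density_mean X p \<phi> = (if bounded (\<phi> ` X) then \<Sum>\<^sub>\<infinity>x\<in>X. of_real (p x) * \<phi> x else 0)"

lemma mean_on_density_mean:
  assumes p: "\<And>x. x \<in> X \<Longrightarrow> 0 \<le> p x" and s: "(p has_sum 1) X"
  shows "mean_on X (density_mean X p)"
proof -
  have ps: "p summable_on X" and p1: "(\<Sum>\<^sub>\<infinity>x\<in>X. p x) = 1"
    using s by (auto simp: has_sum_iff)
  have sm: "(\<lambda>x. of_real (p x) * \<phi> x) summable_on X" if "bounded (\<phi> ` X)" for \<phi> :: "'a \<Rightarrow> complex"
  proof -
    from that obtain B where "\<And>x. x \<in> X \<Longrightarrow> cmod (\<phi> x) \<le> B"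
      by (auto simp: bounded_iff)
    then show ?thesis using abs_summable_density(1)[OF p ps] by blast
  qed
  show ?thesis
    unfolding mean_on_def
  proof (intro conjI allI impI)
    fix \<phi> \<psi> :: "'a \<Rightarrow> complex"
    assume b: "bounded (\<phi> ` X)" "bounded (\<psi> ` X)"
    show "density_mean X p (\<lambda>x. \<phi> x + \<psi> x) = density_mean X p \<phi> + density_mean X p \<psi>"
      using b bounded_fun_plus[OF b] infsum_add[OF sm[OF b(1)] sm[OF b(2)]]
      by (simp add: density_mean_def distrib_left)
  next
    fix c and \<phi> :: "'a \<Rightarrow> complex"
    assume b: "bounded (\<phi> ` X)"
    have "(\<Sum>\<^sub>\<infinity>x\<in>X. of_real (p x) * (c * \<phi> x)) = c * (\<Sum>\<^sub>\<infinity>x\<in>X. of_real (p x) * \<phi> x)"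
      by (simp add: mult.left_commute[of _ c] infsum_cmult_right[OF sm[OF b]])
    then show "density_mean X p (\<lambda>x. c * \<phi> x) = c * density_mean X p \<phi>"
      using b bounded_fun_cmult[OF b] by (simp add: density_mean_def)
  next
    fix \<phi> :: "'a \<Rightarrow> complex" and B
    assume B: "\<forall>x\<in>X. cmod (\<phi> x) \<le> B"
    have "X \<noteq> {}" using p1 by auto
    then have "0 \<le> B" using B norm_ge_zero order_trans by blast
    then show "cmod (density_mean X p \<phi>) \<le> B"
      using abs_summable_density(2)[OF p ps, of \<phi> B] B p1 by (auto simp: density_mean_def)
  next
    fix \<phi> :: "'a \<Rightarrow> complex"
    assume b: "bounded (\<phi> ` X)" and nn: "\<forall>x\<in>X. \<phi> x \<in> \<real>\<^sub>\<ge>\<^sub>0"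
    have "0 \<le> (\<Sum>\<^sub>\<infinity>x\<in>X. of_real (p x) * \<phi> x)"
      using nn p by (intro infsum_nonneg_complex[OF sm[OF b]])
        (auto simp: complex_nonneg_Reals_iff less_eq_complex_def nonneg_Reals_def elim!: Reals_cases)
    then show "density_mean X p \<phi> \<in> \<real>\<^sub>\<ge>\<^sub>0"
      using b by (auto simp: density_mean_def complex_nonneg_Reals_iff less_eq_complex_def)
  next
    have "(\<Sum>\<^sub>\<infinity>x\<in>X. complex_of_real (p x)) = 1"
      using infsumI[OF has_sum_of_real[OF s]] by simp
    then show "density_mean X p (\<lambda>_. 1) = 1"
      by (simp add: density_mean_def image_constant_conv)
  qed
qed

text \<open>A change of variables moves the shift from \<open>\<phi>\<close> to the density, so the
  defect of invariance is controlled by the increment of \<open>p\<close> in the l1 norm.\<close>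

lemma density_mean_shift:
  assumes p: "\<And>x. x \<in> X \<Longrightarrow> 0 \<le> p x" "p summable_on X" and \<alpha>: "bij_betw \<alpha> X X"
    and B: "\<And>x. x \<in> X \<Longrightarrow> cmod (\<phi> x) \<le> B"
  shows "cmod (density_mean X p (\<phi> \<circ> \<alpha>) - density_mean X p \<phi>) \<le> B * (\<Sum>\<^sub>\<infinity>x\<in>X. \<bar>p (\<alpha> x) - p x\<bar>)"
proof -
  have aX: "\<alpha> x \<in> X" if "x \<in> X" for x
    using \<alpha> that by (auto simp: bij_betw_def)
  have b: "bounded (\<phi> ` X)" "bounded ((\<phi> \<circ> \<alpha>) ` X)"
    using B aX by (force simp: bounded_iff)+
  have pa: "(\<lambda>x. p (\<alpha> x)) summable_on X"
    using p(2) summable_on_reindex_bij_betw[OF \<alpha>, of p] by simp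
  have eq: "(\<Sum>\<^sub>\<infinity>x\<in>X. of_real (p x) * \<phi> x) = (\<Sum>\<^sub>\<infinity>x\<in>X. of_real (p (\<alpha> x)) * \<phi> (\<alpha> x))"
    using infsum_reindex_bij_betw[OF \<alpha>, of "\<lambda>x. of_real (p x) * \<phi> x"] by simp
  have d: "(\<lambda>x. \<bar>p (\<alpha> x) - p x\<bar>) summable_on X"
    using infsum_minus(1)[OF pa p(2)] summable_on_iff_abs_summable_on_real by fastforce
  have Ba: "cmod (\<phi> (\<alpha> x)) \<le> B" if "x \<in> X" for x
    using B aX that by blast
  have s1: "(\<lambda>x. of_real (p x) * \<phi> (\<alpha> x)) summable_on X"
    by (rule abs_summable_density(1)[OF p Ba])
  have s2: "(\<lambda>x. of_real (p (\<alpha> x)) * \<phi> (\<alpha> x)) summable_on X"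
    by (rule abs_summable_density(1)[OF _ pa Ba]) (use p aX in auto)
  have "density_mean X p (\<phi> \<circ> \<alpha>) - density_mean X p \<phi>
      = (\<Sum>\<^sub>\<infinity>x\<in>X. of_real (p x) * \<phi> (\<alpha> x)) - (\<Sum>\<^sub>\<infinity>x\<in>X. of_real (p (\<alpha> x)) * \<phi> (\<alpha> x))"
    using b eq by (simp add: density_mean_def)
  also have "\<dots> = (\<Sum>\<^sub>\<infinity>x\<in>X. of_real (p x) * \<phi> (\<alpha> x) - of_real (p (\<alpha> x)) * \<phi> (\<alpha> x))"
    by (rule infsum_minus(2)[symmetric, OF s1 s2])
  \<comment> \<open>Splitting off the sign leaves the density
    \<open>\<bar>p (\<alpha> x) - p x\<bar>\<close> against a function still bounded by
    \<open>B\<close>, to which the general estimate for densities applies.\<close>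
  also have "\<dots> = (\<Sum>\<^sub>\<infinity>x\<in>X. of_real \<bar>p (\<alpha> x) - p x\<bar> * (- sgn (p (\<alpha> x) - p x) * \<phi> (\<alpha> x)))"
    by (intro infsum_cong) (simp add: sgn_real_def abs_if algebra_simps)
  also have "cmod \<dots> \<le> B * (\<Sum>\<^sub>\<infinity>x\<in>X. \<bar>p (\<alpha> x) - p x\<bar>)"
  proof (rule abs_summable_density(2)[OF _ d])
    fix x assume x: "x \<in> X"
    have "0 \<le> B" using Ba[OF x] norm_ge_zero order_trans by blast
    then show "cmod (- sgn (p (\<alpha> x) - p x) * \<phi> (\<alpha> x)) \<le> B"
      using Ba[OF x] by (auto simp: norm_mult sgn_real_def)
  qed simp
  finally show ?thesis .
qed

lemma closed_mean_on: "closed {m. mean_on X m}"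
proof -
  have c: "continuous_on UNIV (\<lambda>m :: ('a \<Rightarrow> complex) \<Rightarrow> complex. m \<phi>)" for \<phi>
    by (rule continuous_on_product_coordinates)
  have R: "closed {m :: ('a \<Rightarrow> complex) \<Rightarrow> complex. m \<phi> \<in> \<real>\<^sub>\<ge>\<^sub>0}" for \<phi>
    using closed_vimage[OF closed_nonneg_Reals_complex c[of \<phi>]] by (simp add: vimage_def)
  have "closed {m :: ('a \<Rightarrow> complex) \<Rightarrow> complex. m (\<lambda>x. \<phi> x + \<psi> x) = m \<phi> + m \<psi>}" for \<phi> \<psi>
    by (intro closed_Collect_eq continuous_intros c)
  moreover have "closed {m :: ('a \<Rightarrow> complex) \<Rightarrow> complex. m (\<lambda>x. k * \<phi> x) = k * m \<phi>}" for k \<phi>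
    by (intro closed_Collect_eq continuous_intros c)
  moreover have "closed {m :: ('a \<Rightarrow> complex) \<Rightarrow> complex. cmod (m \<phi>) \<le> B}" for B \<phi>
    by (intro closed_Collect_le continuous_intros c)
  moreover have "closed {m :: ('a \<Rightarrow> complex) \<Rightarrow> complex. m (\<lambda>_. 1) = 1}"
    by (intro closed_Collect_eq continuous_intros c)
  ultimately show ?thesis
    unfolding mean_on_def using R
    by (intro closed_Collect_conj closed_Collect_all closed_Collect_imp) auto
qed

text \<open>Countability of \<open>I\<close> gives an exhaustion by finite sets \<open>K N\<close>.
  Densities that are almost invariant on \<open>K N\<close> up to \<open>1 / (N + 1)\<close> define
  means, and a cluster point of these in a compact product is invariant under every index.\<close>

lemma invariant_mean_exists:
  fixes X :: "'x set" and \<alpha> :: "'i \<Rightarrow> 'x \<Rightarrow> 'x"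
  assumes I: "countable I" and \<alpha>: "\<And>i. i \<in> I \<Longrightarrow> bij_betw (\<alpha> i) X X"
    and approx: "\<And>K \<delta> :: real. finite K \<Longrightarrow> K \<subseteq> I \<Longrightarrow> \<delta> > 0 \<Longrightarrow>
      \<exists>p. (\<forall>x\<in>X. 0 \<le> p x) \<and> (p has_sum 1) X \<and> (\<forall>i\<in>K. (\<Sum>\<^sub>\<infinity>x\<in>X. \<bar>p (\<alpha> i x) - p x\<bar>) \<le> \<delta>)"
  obtains m where "mean_on X m"
    and "\<And>i \<phi>. i \<in> I \<Longrightarrow> bounded (\<phi> ` X) \<Longrightarrow> m (\<phi> \<circ> \<alpha> i) = m \<phi>"
proof -
  define K where "K N = {i \<in> I. to_nat_on I i \<le> N}" for N :: nat
  have finK: "finite (K N)" for N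
  proof (rule finite_imageD)
    show "finite (to_nat_on I ` K N)"
      by (rule finite_subset[of _ "{..N}"]) (auto simp: K_def)
    show "inj_on (to_nat_on I) (K N)"
      using inj_on_to_nat_on[OF I] by (rule inj_on_subset) (auto simp: K_def)
  qed
  have "\<exists>p. (\<forall>x\<in>X. 0 \<le> p x) \<and> (p has_sum 1) X \<and>
      (\<forall>i\<in>K N. (\<Sum>\<^sub>\<infinity>x\<in>X. \<bar>p (\<alpha> i x) - p x\<bar>) \<le> inverse (real (Suc N)))" for N
    using approx[OF finK, of N "inverse (real (Suc N))"] by (auto simp: K_def)
  then obtain p where p: "\<And>N x. x \<in> X \<Longrightarrow> 0 \<le> p N x" "\<And>N. (p N has_sum 1) X"
      "\<And>N i. i \<in> K N \<Longrightarrow> (\<Sum>\<^sub>\<infinity>x\<in>X. \<bar>p N (\<alpha> i x) - p N x\<bar>) \<le> inverse (real (Suc N))"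
    by metis
  define M where "M N = density_mean X (p N)" for N
  have M: "mean_on X (M N)" for N
    unfolding M_def by (rule mean_on_density_mean) (use p in auto)
  \<comment> \<open>One radius per function that serves all \<open>M N\<close> at once; the value 0
    off the bounded functions matches the default of \<open>density_mean\<close>.\<close>
  define b where "b \<phi> = (if bounded (\<phi> ` X) then SOME B. \<forall>x\<in>X. cmod (\<phi> x) \<le> B else 0)"
    for \<phi> :: "'x \<Rightarrow> complex"
  have b: "cmod (\<phi> x) \<le> b \<phi>" if "bounded (\<phi> ` X)" "x \<in> X" for \<phi> x
  proof -
    have "\<exists>B. \<forall>x\<in>X. cmod (\<phi> x) \<le> B"
      using that(1) by (auto simp: bounded_iff)
    then have "\<forall>x\<in>X. cmod (\<phi> x) \<le> (SOME B. \<forall>x\<in>X. cmod (\<phi> x) \<le> B)"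
      by (rule someI_ex)
    then show ?thesis using that by (simp add: b_def)
  qed
  define S where "S = {m. \<forall>\<phi>. cmod (m \<phi>) \<le> b \<phi>}"
  have "compact S"
    unfolding S_def by (rule compact_pointwise_bounded)
  have "M N \<in> S" for N
    unfolding S_def
  proof (intro CollectI allI)
    fix \<phi> :: "'x \<Rightarrow> complex"
    show "cmod (M N \<phi>) \<le> b \<phi>"
    proof (cases "bounded (\<phi> ` X)")
      case True
      then show ?thesis using M[of N] b by (simp add: mean_on_def)
    next
      case False
      then show ?thesis by (simp add: M_def density_mean_def b_def)
    qed
  qed
  then have "eventually (\<lambda>m. m \<in> S) (filtermap M sequentially)"
    by (simp add: eventually_filtermap)
  moreover have "filtermap M sequentially \<noteq> bot"
    by (simp add: filtermap_bot_iff)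
  ultimately obtain m where m: "inf (nhds m) (filtermap M sequentially) \<noteq> bot"
    using \<open>compact S\<close> unfolding compact_filter by blast
  show thesis
  proof
    show "mean_on X m"
      using cluster_point_in_closed[OF m closed_mean_on[of X]] M by (simp add: eventually_filtermap)
  next
    fix i and \<phi> :: "'x \<Rightarrow> complex"
    assume i: "i \<in> I" and bd: "bounded (\<phi> ` X)"
    have b': "cmod (\<phi> x) \<le> \<bar>b \<phi>\<bar>" if "x \<in> X" for x
      using b[OF bd that] by simp
    \<comment> \<open>Invariance up to \<open>e\<close> is a closed condition on two coordinates, so
      it passes to the cluster point.\<close>
    have "m \<in> {m. cmod (m (\<phi> \<circ> \<alpha> i) - m \<phi>) \<le> e}" if "e > 0" for e
    proof (rule cluster_point_in_closed[OF m])
      show "closed {m. cmod (m (\<phi> \<circ> \<alpha> i) - m \<phi>) \<le> e}"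
        by (intro closed_Collect_le continuous_intros continuous_on_product_coordinates)
      have "(\<lambda>N. \<bar>b \<phi>\<bar> * inverse (real (Suc N))) \<longlonglongrightarrow> \<bar>b \<phi>\<bar> * 0"
        by (intro tendsto_intros LIMSEQ_inverse_real_of_nat)
      then have "eventually (\<lambda>N. \<bar>b \<phi>\<bar> * inverse (real (Suc N)) < e) sequentially"
        using that by (auto intro: order_tendstoD)
      moreover have "eventually (\<lambda>N. i \<in> K N) sequentially"
        using i by (auto simp: K_def eventually_sequentially)
      ultimately have "eventually (\<lambda>N. cmod (M N (\<phi> \<circ> \<alpha> i) - M N \<phi>) \<le> e) sequentially"
      proof eventually_elim
        case (elim N)
        have "cmod (M N (\<phi> \<circ> \<alpha> i) - M N \<phi>) \<le> \<bar>b \<phi>\<bar> * (\<Sum>\<^sub>\<infinity>x\<in>X. \<bar>p N (\<alpha> i x) - p N x\<bar>)"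
          unfolding M_def
          by (rule density_mean_shift[OF p(1) has_sum_imp_summable[OF p(2)] \<alpha>[OF i] b'])
        also have "\<dots> \<le> \<bar>b \<phi>\<bar> * inverse (real (Suc N))"
          using p(3)[OF elim(2)] by (intro mult_left_mono) auto
        finally show ?case using elim(1) by linarith
      qed
      then show "eventually (\<lambda>m. m \<in> {m. cmod (m (\<phi> \<circ> \<alpha> i) - m \<phi>) \<le> e}) (filtermap M sequentially)"
        by (simp add: eventually_filtermap)
    qed
    then have "cmod (m (\<phi> \<circ> \<alpha> i) - m \<phi>) \<le> 0 + e" if "e > 0" for e
      using that by (metis (lifting) add_0 mem_Collect_eq)
    then have "cmod (m (\<phi> \<circ> \<alpha> i) - m \<phi>) \<le> 0"
      by (rule field_le_epsilon)
    then show "m (\<phi> \<circ> \<alpha> i) = m \<phi>" by simp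
  qed
qed

text \<open>The alternative to an invariant mean, in a form that is homogeneous in \<open>p\<close>.\<close>

definition gap_on :: "'x set \<Rightarrow> 'i set \<Rightarrow> ('i \<Rightarrow> 'x \<Rightarrow> 'x) \<Rightarrow> real \<Rightarrow> bool" where
  "gap_on X K \<alpha> \<delta> \<longleftrightarrow> (\<forall>p D. (\<forall>x\<in>X. 0 \<le> p x) \<longrightarrow> p summable_on X \<longrightarrow> 0 \<le> D \<longrightarrow>
     (\<forall>i\<in>K. (\<Sum>\<^sub>\<infinity>x\<in>X. \<bar>p (\<alpha> i x) - p x\<bar>) \<le> D) \<longrightarrow> \<delta> * (\<Sum>\<^sub>\<infinity>x\<in>X. p x) \<le> D)"

text \<open>If every gap fails, the violating functions, once normalised, are almost invariant
  probability densities, and these produce an invariant mean.\<close>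

lemma invariant_mean_or_gap:
  fixes X :: "'x set" and \<alpha> :: "'i \<Rightarrow> 'x \<Rightarrow> 'x"
  assumes I: "countable I" and \<alpha>: "\<And>i. i \<in> I \<Longrightarrow> bij_betw (\<alpha> i) X X"
    and no_mean: "\<And>m. mean_on X m \<Longrightarrow>
      (\<And>i \<phi>. i \<in> I \<Longrightarrow> bounded (\<phi> ` X) \<Longrightarrow> m (\<phi> \<circ> \<alpha> i) = m \<phi>) \<Longrightarrow> False"
  obtains K and \<delta> :: real where "finite K" "K \<subseteq> I" "\<delta> > 0" "gap_on X K \<alpha> \<delta>"
proof -
  have "\<exists>K. \<exists>\<delta>::real. finite K \<and> K \<subseteq> I \<and> \<delta> > 0 \<and> gap_on X K \<alpha> \<delta>"
  proof (rule ccontr)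
    assume neg: "\<not> ?thesis"
    have approx: "\<exists>p. (\<forall>x\<in>X. 0 \<le> p x) \<and> (p has_sum 1) X \<and> (\<forall>i\<in>K. (\<Sum>\<^sub>\<infinity>x\<in>X. \<bar>p (\<alpha> i x) - p x\<bar>) \<le> \<delta>)"
      if K: "finite K" "K \<subseteq> I" and \<delta>: "\<delta> > 0" for K and \<delta> :: real
    proof -
      from neg K \<delta> have "\<not> gap_on X K \<alpha> \<delta>" by blast
      then obtain p D where p: "\<forall>x\<in>X. 0 \<le> p x" "p summable_on X" "0 \<le> D"
          "\<forall>i\<in>K. (\<Sum>\<^sub>\<infinity>x\<in>X. \<bar>p (\<alpha> i x) - p x\<bar>) \<le> D" "D < \<delta> * (\<Sum>\<^sub>\<infinity>x\<in>X. p x)"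
        unfolding gap_on_def by (auto simp: not_le)
      define s where "s = (\<Sum>\<^sub>\<infinity>x\<in>X. p x)"
      \<comment> \<open>The failed inequality together with \<open>0 \<le> D\<close> forces positive
        mass, even when \<open>K\<close> is empty, so \<open>p\<close> can be normalised.\<close>
      have s: "s > 0"
        using p(3,5) \<delta> unfolding s_def by (metis order.strict_trans1 zero_less_mult_pos)
      have "((\<lambda>x. p x / s) has_sum (s / s)) X"
        using has_sum_cmult_left[OF has_sum_infsum[OF p(2)], of "inverse s"]
        unfolding s_def[symmetric] divide_inverse .
      moreover have "(\<Sum>\<^sub>\<infinity>x\<in>X. \<bar>p (\<alpha> i x) / s - p x / s\<bar>) \<le> \<delta>" if "i \<in> K" for i
      proof -
        have "(\<Sum>\<^sub>\<infinity>x\<in>X. \<bar>p (\<alpha> i x) / s - p x / s\<bar>) = (\<Sum>\<^sub>\<infinity>x\<in>X. inverse s * \<bar>p (\<alpha> i x) - p x\<bar>)"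
          using s by (intro infsum_cong) (simp add: abs_mult divide_inverse flip: left_diff_distrib)
        also have "\<dots> = inverse s * (\<Sum>\<^sub>\<infinity>x\<in>X. \<bar>p (\<alpha> i x) - p x\<bar>)"
          by (rule infsum_cmult_right')
        also have "\<dots> \<le> inverse s * D"
          using p(4) that s by (intro mult_left_mono) auto
        also have "\<dots> \<le> \<delta>"
          using p(5) s unfolding s_def[symmetric] by (simp add: field_simps)
        finally show ?thesis .
      qed
      ultimately show ?thesis
        using s p(1) by (intro exI[of _ "\<lambda>x. p x / s"]) auto
    qed
    show False
      by (rule invariant_mean_exists[OF I \<alpha> approx no_mean])
  qed
  then show thesis using that by blast
qed

section \<open>States and positivity\<close>

lemma star_one [simp]: "star (1::'a::cstar_algebra) = 1"
  using star_mult[of "star (1::'a)" 1] by (simp add: star_star)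

lemma star_scaleR: "star (r *\<^sub>R x) = r *\<^sub>R star (x::'a::cstar_algebra)"
  by (simp add: star_scaleC flip: scaleC_of_real)

lemma star_minus: "star (- x) = - star (x::'a::cstar_algebra)"
  using star_scaleR[of "-1" x] by simp

lemma star_power: "star (x ^ n) = star (x::'a::cstar_algebra) ^ n"
  by (induction n) (simp_all add: star_mult power_commutes)

lemma norm_star [simp]: "norm (star x) = norm (x::'a::cstar_algebra)"
proof -
  have le: "norm y \<le> norm (star y)" for y :: 'a
  proof (cases "y = 0")
    case False
    have "norm y * norm y \<le> norm (star y) * norm y"
      using cstar_identity[of y] norm_mult_ineq[of "star y" y] by (simp add: power2_eq_square)
    then show ?thesis using False by simp
  qed simp
  show ?thesis using le[of x] le[of "star x"] by (simp add: star_star)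
qed

lemma bounded_linear_star: "bounded_linear (star :: 'a::cstar_algebra \<Rightarrow> 'a)"
  by (rule bounded_linear_intro[where K = 1]) (simp_all add: star_add star_scaleR)

text \<open>Consecutive coefficients have ratio \<open>(1/2 - n) / (n + 1)\<close>, of modulus at
  most 1. This crude bound suffices to dominate the square root series by a geometric one.\<close>

lemma abs_gbinomial_half_le: "\<bar>(1/2 :: real) gchoose n\<bar> \<le> 1"
proof (induction n)
  case (Suc n)
  have "((1/2 :: real) gchoose Suc n) = (1/2 gchoose n) * ((1/2 - real n) / (real n + 1))"
    using gbinomial_mult_1[of "1/2 :: real" n] by (simp add: field_simps)
  also have "\<bar>\<dots>\<bar> \<le> 1 * 1"
    unfolding abs_mult using Suc by (intro mult_mono) (auto simp: abs_if field_simps)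
  finally show ?case by simp
qed simp

text \<open>The square root is the binomial series of \<open>(1 - x)\<close> with exponent one half.\<close>

lemma one_minus_eq_star_mult:
  fixes x :: "'a::cstar_algebra"
  assumes sa: "star x = x" and x: "norm x < 1"
  obtains s where "1 - x = star s * s"
proof -
  define c where "c n = (1/2 :: real) gchoose n" for n
  define a where "a n = c n *\<^sub>R (- x) ^ n" for n
  define s where "s = (\<Sum>n. a n)"
  have "norm (a n) \<le> norm x ^ n" for n
  proof -
    have "norm (a n) \<le> 1 * norm (- x) ^ n"
      unfolding a_def norm_scaleR c_def using abs_gbinomial_half_le norm_power_ineq[of "- x" n]
      by (intro mult_mono) auto
    then show ?thesis by simp
  qed
  then have sum: "summable (\<lambda>n. norm (a n))"
    using x by (intro summable_comparison_test'[OF summable_geometric[of "norm x"]]) auto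
  \<comment> \<open>Vandermonde's convolution turns the Cauchy square of the series with exponent
    1/2 into the series with exponent 1, which stops at \<open>1 - x\<close>.\<close>
  have "(\<Sum>i\<le>k. a i * a (k - i)) = (1 gchoose k) *\<^sub>R (- x) ^ k" for k
  proof -
    have "(\<Sum>i\<le>k. a i * a (k - i)) = (\<Sum>i\<le>k. (c i * c (k - i)) *\<^sub>R (- x) ^ k)"
      by (intro sum.cong) (auto simp: a_def mult.commute simp flip: power_add)
    also have "\<dots> = (\<Sum>i=0..k. c i * c (k - i)) *\<^sub>R (- x) ^ k"
      by (simp add: scaleR_sum_left atMost_atLeast0)
    also have "(\<Sum>i=0..k. c i * c (k - i)) = 1 gchoose k"
      unfolding c_def by (simp add: gbinomial_Vandermonde)
    finally show ?thesis .
  qed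
  then have "(\<lambda>k. (1 gchoose k) *\<^sub>R (- x) ^ k) sums (s * s)"
    using Cauchy_product_sums[OF sum sum] by (simp add: s_def)
  moreover have "(\<lambda>k. (1 gchoose k) *\<^sub>R (- x) ^ k) sums (\<Sum>k\<in>{0,1}. (1 gchoose k) *\<^sub>R (- x) ^ k)"
  proof (rule sums_finite)
    fix k :: nat assume "k \<notin> {0, 1}"
    then have "1 < k" by auto
    then have "((1::real) gchoose k) = 0"
      using binomial_gbinomial[of 1 k, where 'a = real] by (simp add: binomial_eq_0)
    then show "((1::real) gchoose k) *\<^sub>R (- x) ^ k = 0" by simp
  qed simp
  ultimately have "s * s = 1 - x"
    by (auto dest: sums_unique2)
  moreover have "star s = s"
  proof -
    have "star s = (\<Sum>n. star (a n))"
      unfolding s_def by (rule bounded_linear.suminf[OF bounded_linear_star summable_norm_cancel[OF sum]])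
    also have "(\<lambda>n. star (a n)) = a"
      by (rule ext) (simp add: a_def star_scaleR star_power star_minus sa)
    finally show ?thesis by (simp add: s_def)
  qed
  ultimately show thesis using that by metis
qed

lemma is_stateD:
  assumes "is_state \<rho>"
  shows "\<rho> (a + b) = \<rho> a + \<rho> b" "\<rho> (c *\<^sub>C a) = c * \<rho> a" "\<rho> (star a * a) \<in> \<real>\<^sub>\<ge>\<^sub>0"
    "cmod (\<rho> a) \<le> norm a" "\<rho> 1 = 1"
  using assms unfolding is_state_def by blast+

lemma state_scaleR: "is_state \<rho> \<Longrightarrow> \<rho> (r *\<^sub>R a) = r * \<rho> a"
  using is_stateD(2)[of \<rho> "complex_of_real r" a] by (simp add: scaleC_of_real)

lemma bounded_linear_state: "is_state \<rho> \<Longrightarrow> bounded_linear \<rho>"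
  by (rule bounded_linear_intro[where K = 1])
    (simp_all add: is_stateD state_scaleR scaleR_conv_of_real[where 'a = complex])

text \<open>The squared GNS seminorm of \<open>\<rho>\<close>. Unlike \<open>sharp_norm\<close> it
  is one-sided, and on a matrix it sees only the first column.\<close>

definition state_sq :: "('a::cstar_algebra \<Rightarrow> complex) \<Rightarrow> 'a \<Rightarrow> real" where
  "state_sq \<rho> a = Re (\<rho> (star a * a))"

lemma state_sq_nonneg: "is_state \<rho> \<Longrightarrow> 0 \<le> state_sq \<rho> a"
  using is_stateD(3)[of \<rho> a] by (simp add: state_sq_def complex_nonneg_Reals_iff)

lemma state_sq_le_norm: "is_state \<rho> \<Longrightarrow> state_sq \<rho> a \<le> (norm a)\<^sup>2"
  unfolding state_sq_def
  by (metis complex_Re_le_cmod cstar_identity is_stateD(4) order_trans)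

lemma tendsto_state_sq:
  assumes "is_state \<rho>" "f \<longlonglongrightarrow> a"
  shows "(\<lambda>i. state_sq \<rho> (f i)) \<longlonglongrightarrow> state_sq \<rho> a"
  unfolding state_sq_def
  by (intro tendsto_Re bounded_linear.tendsto[OF bounded_linear_state[OF assms(1)]]
      tendsto_mult bounded_linear.tendsto[OF bounded_linear_star] assms(2))

lemma sharp_norm_eq: "is_state \<rho> \<Longrightarrow> sharp_norm \<rho> a = sqrt ((state_sq \<rho> (star a) + state_sq \<rho> a) / 2)"
  by (simp add: sharp_norm_def state_sq_def star_star)

lemma sharp_norm_le_norm:
  assumes "is_state \<rho>"
  shows "sharp_norm \<rho> a \<le> norm a"
proof -
  have "(state_sq \<rho> (star a) + state_sq \<rho> a) / 2 \<le> (norm a)\<^sup>2"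
    using state_sq_le_norm[OF assms, of a] state_sq_le_norm[OF assms, of "star a"] by simp
  then show ?thesis
    using real_sqrt_le_mono[of _ "(norm a)\<^sup>2"] by (simp add: sharp_norm_eq[OF assms])
qed

lemma state_sq_le_sharp_norm:
  assumes "is_state \<rho>"
  shows "state_sq \<rho> a \<le> 2 * (sharp_norm \<rho> a)\<^sup>2"
  using state_sq_nonneg[OF assms, of a] state_sq_nonneg[OF assms, of "star a"]
  by (simp add: sharp_norm_eq[OF assms])

text \<open>For \<open>r < 1\<close> the element \<open>1 - r *\<^sub>R (star d * d)\<close> is a
  square \<open>star s * s\<close> inside the domain of \<open>\<iota>\<close>, and
  \<open>\<iota>\<close> carries this identity over. So only the norm of \<open>d\<close> enters,
  and no estimate for the norm of \<open>\<iota> d\<close>. At the end \<open>r\<close> tends to 1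
  from below.\<close>

lemma state_sq_mult_le:
  fixes \<iota> :: "'d::cstar_algebra \<Rightarrow> 'a::cstar_algebra"
  assumes \<rho>: "is_state \<rho>"
    and add: "\<And>x y. \<iota> (x + y) = \<iota> x + \<iota> y" and scale: "\<And>c x. \<iota> (c *\<^sub>C x) = c *\<^sub>C \<iota> x"
    and mult: "\<And>x y. \<iota> (x * y) = \<iota> x * \<iota> y" and star: "\<And>x. \<iota> (star x) = star (\<iota> x)"
    and one: "\<iota> 1 = 1"
    and d: "norm d \<le> 1"
  shows "state_sq \<rho> (\<iota> d * b) \<le> state_sq \<rho> b"
proof -
  have "r * state_sq \<rho> (\<iota> d * b) \<le> state_sq \<rho> b" if r: "0 < r" "r < 1" for r
  proof -
    define x where "x = r *\<^sub>R (star d * d)"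
    have "norm x = r * (norm d)\<^sup>2"
      using r by (simp add: x_def cstar_identity)
    also have "\<dots> < 1"
      using r power_le_one[OF norm_ge_zero d, of 2] mult_left_mono[of "(norm d)\<^sup>2" 1 r] by linarith
    finally have "norm x < 1" .
    moreover have "star x = x"
      by (simp add: x_def star_scaleR star_mult star_star)
    ultimately obtain s where s: "1 - x = star s * s"
      using one_minus_eq_star_mult by blast
    then have "1 = star s * s + x" by (simp add: algebra_simps)
    then have "1 = star (\<iota> s) * \<iota> s + r *\<^sub>R (star (\<iota> d) * \<iota> d)"
      using one add[of "star s * s" x] scale[of "of_real r" "star d * d"]
      by (simp add: x_def scaleC_of_real mult star)
    then have "star b * 1 * b = star b * (star (\<iota> s) * \<iota> s + r *\<^sub>R (star (\<iota> d) * \<iota> d)) * b"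
      by simp
    also have "\<dots> = star (\<iota> s * b) * (\<iota> s * b) + r *\<^sub>R (star (\<iota> d * b) * (\<iota> d * b))"
      by (simp add: star_mult algebra_simps)
    finally have "state_sq \<rho> b = state_sq \<rho> (\<iota> s * b) + r * state_sq \<rho> (\<iota> d * b)"
      by (simp add: state_sq_def is_stateD(1)[OF \<rho>] state_scaleR[OF \<rho>])
    then show ?thesis
      using state_sq_nonneg[OF \<rho>, of "\<iota> s * b"] by simp
  qed
  then have "\<forall>\<^sub>F r in at_left 1. r * state_sq \<rho> (\<iota> d * b) \<le> state_sq \<rho> b"
    using eventually_at_left_real[of 0 "1::real"] by (auto elim!: eventually_mono)
  moreover have "((\<lambda>r. r * state_sq \<rho> (\<iota> d * b)) \<longlongrightarrow> 1 * state_sq \<rho> (\<iota> d * b)) (at_left 1)"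
    by (intro tendsto_intros)
  ultimately have "1 * state_sq \<rho> (\<iota> d * b) \<le> state_sq \<rho> b"
    by (intro tendsto_upperbound[of _ _ "at_left (1::real)"]) auto
  then show ?thesis by simp
qed

section \<open>Spectral gaps of groups that are not inner amenable\<close>

text \<open>Young's inequality with a free parameter: the loss \<open>1 + t\<close> on the main term
  can be brought close to 1, while the large factor \<open>1 + 1 / t\<close> falls on a term that
  will be small.\<close>

lemma real_add_sq_le:
  fixes x y t :: real
  assumes "t > 0"
  shows "(x + y)\<^sup>2 \<le> (1 + t) * x\<^sup>2 + (1 + 1 / t) * y\<^sup>2"
proof -
  have "(1 + t) * x\<^sup>2 + (1 + 1 / t) * y\<^sup>2 - (x + y)\<^sup>2 = (t * x - y)\<^sup>2 / t"
    using assms by (simp add: field_simps power2_eq_square)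
  also have "\<dots> \<ge> 0" using assms by simp
  finally show ?thesis by linarith
qed

lemma cmod_add_sq_le:
  assumes "t > 0"
  shows "(cmod (a + b))\<^sup>2 \<le> (1 + t) * (cmod a)\<^sup>2 + (1 + 1 / t) * (cmod b)\<^sup>2"
proof -
  have "(cmod (a + b))\<^sup>2 \<le> (cmod a + cmod b)\<^sup>2"
    by (intro power_mono norm_triangle_ineq) simp
  then show ?thesis using real_add_sq_le[OF assms] by (rule order_trans)
qed

text \<open>Since \<open>p \<circ> \<alpha>\<close> and \<open>p\<close> have the same sum, a one-sided bound on the increment suffices.\<close>

lemma infsum_abs_increment_le:
  fixes p q :: "'x \<Rightarrow> real"
  assumes \<alpha>: "bij_betw \<alpha> X X" and p: "\<And>x. x \<in> X \<Longrightarrow> 0 \<le> p x" "p summable_on X"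
    and q: "\<And>x. x \<in> X \<Longrightarrow> 0 \<le> q x" "q summable_on X" and nn: "0 \<le> t" "0 \<le> c"
    and le: "\<And>x. x \<in> X \<Longrightarrow> p (\<alpha> x) \<le> (1 + t) * p x + c * q x"
  shows "(\<Sum>\<^sub>\<infinity>x\<in>X. \<bar>p (\<alpha> x) - p x\<bar>) \<le> 2 * (t * (\<Sum>\<^sub>\<infinity>x\<in>X. p x) + c * (\<Sum>\<^sub>\<infinity>x\<in>X. q x))"
proof -
  have pa: "(\<lambda>x. p (\<alpha> x)) summable_on X"
    using p(2) summable_on_reindex_bij_betw[OF \<alpha>, of p] by simp
  have eq: "(\<Sum>\<^sub>\<infinity>x\<in>X. p (\<alpha> x)) = (\<Sum>\<^sub>\<infinity>x\<in>X. p x)"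
    by (rule infsum_reindex_bij_betw[OF \<alpha>])
  note d = infsum_minus[OF pa p(2)]
  have da: "(\<lambda>x. \<bar>p (\<alpha> x) - p x\<bar>) summable_on X"
    using d(1) summable_on_iff_abs_summable_on_real by fastforce
  have tc: "(\<lambda>x. t * p x) summable_on X" "(\<lambda>x. c * q x) summable_on X"
    using p q by (auto intro: summable_on_cmult_right)
  have b: "(\<lambda>x. 2 * (t * p x + c * q x)) summable_on X"
    by (intro summable_on_cmult_right summable_on_add tc)
  \<comment> \<open>An increment \<open>z\<close> with \<open>z \<le> w\<close> and
    \<open>0 \<le> w\<close> satisfies \<open>\<bar>z\<bar> \<le> 2 * w - z\<close>; the increments
    of \<open>p\<close> sum to zero, so only \<open>2 * w\<close> remains.\<close>
  have "(\<Sum>\<^sub>\<infinity>x\<in>X. \<bar>p (\<alpha> x) - p x\<bar>) \<le> (\<Sum>\<^sub>\<infinity>x\<in>X. 2 * (t * p x + c * q x) - (p (\<alpha> x) - p x))"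
  proof (rule infsum_mono[OF da infsum_minus(1)[OF b d(1)]])
    fix x assume x: "x \<in> X"
    have "0 \<le> t * p x" "0 \<le> c * q x"
      using p(1) q(1) x nn by auto
    then show "\<bar>p (\<alpha> x) - p x\<bar> \<le> 2 * (t * p x + c * q x) - (p (\<alpha> x) - p x)"
      using le[OF x] by (simp add: abs_if algebra_simps)
  qed
  also have "\<dots> = (\<Sum>\<^sub>\<infinity>x\<in>X. 2 * (t * p x + c * q x))"
    using infsum_minus(2)[OF b d(1)] d(2) eq by simp
  also have "\<dots> = 2 * (t * (\<Sum>\<^sub>\<infinity>x\<in>X. p x) + c * (\<Sum>\<^sub>\<infinity>x\<in>X. q x))"
    by (simp only: infsum_cmult_right' infsum_add[OF tc])
  finally show ?thesis .
qed

lemma linf_bounded: "\<xi> \<in> linf G \<Longrightarrow> bounded (\<xi> ` carrier G)"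
  by (simp add: linf_def)

context group
begin

section \<open>Invariant means on a group and inner amenability\<close>

lemma bij_betw_conjugation:
  assumes "g \<in> carrier G"
  shows "bij_betw (\<lambda>x. inv g \<otimes> x \<otimes> g) (carrier G - {\<one>}) (carrier G - {\<one>})"
proof (rule bij_betw_byWitness[where f' = "\<lambda>x. g \<otimes> x \<otimes> inv g"])
  have 1: "inv g \<otimes> x \<otimes> g = \<one> \<longleftrightarrow> x = \<one>" "g \<otimes> x \<otimes> inv g = \<one> \<longleftrightarrow> x = \<one>" if "x \<in> carrier G" for x
    using assms that
    by (metis inv_closed inv_inv l_inv m_assoc r_inv r_one l_one m_closed)+
  show "(\<lambda>x. inv g \<otimes> x \<otimes> g) ` (carrier G - {\<one>}) \<subseteq> carrier G - {\<one>}"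
    using assms 1 by auto
  show "(\<lambda>x. g \<otimes> x \<otimes> inv g) ` (carrier G - {\<one>}) \<subseteq> carrier G - {\<one>}"
    using assms 1 by auto
  have c: "g \<otimes> (inv g \<otimes> x) = x" "inv g \<otimes> (g \<otimes> x) = x" if "x \<in> carrier G" for x
    using assms that by (simp_all flip: m_assoc)
  show "\<forall>x\<in>carrier G - {\<one>}. g \<otimes> (inv g \<otimes> x \<otimes> g) \<otimes> inv g = x"
    and "\<forall>x\<in>carrier G - {\<one>}. inv g \<otimes> (g \<otimes> x \<otimes> inv g) \<otimes> g = x"
    using assms by (auto simp: m_assoc c)
qed

lemma bij_betw_right_translation:
  assumes "g \<in> carrier G"
  shows "bij_betw (\<lambda>x. x \<otimes> inv g) (carrier G) (carrier G)"
  by (rule bij_betw_byWitness[where f' = "\<lambda>x. x \<otimes> g"]) (use assms in \<open>auto simp: m_assoc\<close>)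

lemma bij_betw_left_translation:
  assumes "g \<in> carrier G"
  shows "bij_betw (\<lambda>x. g \<otimes> x) (carrier G) (carrier G)"
  by (rule bij_betw_byWitness[where f' = "\<lambda>x. inv g \<otimes> x"])
    (use assms in \<open>auto simp flip: m_assoc\<close>)

text \<open>Restricting functions to the complement of \<one> turns \<open>m\<close> into a mean on
  \<open>G\<close> that ignores the neutral element. It is nontrivial because it vanishes on the
  point mass there.\<close>

lemma conj_invariant_mean_inner_amenable:
  assumes m: "mean_on (carrier G - {\<one>}) m"
    and inv: "\<And>g \<phi>. g \<in> carrier G \<Longrightarrow> bounded (\<phi> ` (carrier G - {\<one>})) \<Longrightarrow>
      m (\<phi> \<circ> (\<lambda>x. inv g \<otimes> x \<otimes> g)) = m \<phi>"
  shows "inner_amenable G"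
proof -
  have b: "bounded (\<xi> ` (carrier G - {\<one>}))" if "\<xi> \<in> linf G" for \<xi>
    using linf_bounded[OF that] by (rule bounded_subset) auto
  have "is_mean G m"
    unfolding is_mean_def
  proof (intro conjI ballI allI impI)
    show "m (\<lambda>x. if x \<in> carrier G then 1 else 0) = 1"
      using mean_on_cong[OF m, of "\<lambda>_. 1" "\<lambda>x. if x \<in> carrier G then 1 else 0"] mean_onD(5)[OF m]
      by (simp add: image_constant_conv)
  next
    fix \<xi> assume "\<xi> \<in> linf G" "\<forall>x\<in>carrier G. \<xi> x \<in> \<real>\<^sub>\<ge>\<^sub>0"
    then show "m \<xi> \<in> \<real>\<^sub>\<ge>\<^sub>0"
      using b by (intro mean_onD(4)[OF m]) auto
  qed (use b mean_onD(1,2)[OF m] in auto)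
  moreover have "\<exists>\<xi> \<in> linf G. m \<xi> \<noteq> \<xi> \<one>"
  proof
    let ?d = "\<lambda>x. if x = \<one> then 1 else 0 :: complex"
    show "?d \<in> linf G"
      by (auto simp: linf_def bounded_iff intro!: exI[of _ 1])
    have "cmod (m ?d) \<le> 0"
      by (rule mean_onD(3)[OF m]) auto
    then show "m ?d \<noteq> ?d \<one>" by simp
  qed
  moreover have "m (conj_fun G g \<xi>) = m \<xi>" if "\<xi> \<in> linf G" "g \<in> carrier G" for \<xi> g
  proof -
    have "bounded ((\<xi> \<circ> (\<lambda>x. inv g \<otimes> x \<otimes> g)) ` (carrier G - {\<one>}))"
      using b[OF that(1)] bij_betw_conjugation[OF that(2)]
      unfolding image_comp[symmetric] bij_betw_def by simp
    then have "m (\<xi> \<circ> (\<lambda>x. inv g \<otimes> x \<otimes> g)) = m (conj_fun G g \<xi>)"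
      by (rule mean_on_cong[OF m]) (auto simp: conj_fun_def)
    then show ?thesis using inv[OF that(2) b[OF that(1)]] by simp
  qed
  ultimately show ?thesis unfolding inner_amenable_def by blast
qed

text \<open>
  A right invariant mean \<open>m\<close> yields the mean \<open>\<xi> \<mapsto> m\<^sub>y m\<^sub>z \<xi>(y\<^sup>-\<^sup>1 z)\<close>, which is two-sided invariant.
\<close>

lemma right_invariant_mean_inner_amenable:
  assumes m: "mean_on (carrier G) m" and nontriv: "carrier G \<noteq> {\<one>}"
    and inv: "\<And>g \<phi>. g \<in> carrier G \<Longrightarrow> bounded (\<phi> ` carrier G) \<Longrightarrow> m (\<phi> \<circ> (\<lambda>x. x \<otimes> inv g)) = m \<phi>"
  shows "inner_amenable G"
proof -
  define F where "F \<xi> y = (\<lambda>z. \<xi> (inv y \<otimes> z))" for \<xi> :: "'a \<Rightarrow> complex" and y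
  define h where "h \<xi> y = m (F \<xi> y)" for \<xi> y
  define M where "M \<xi> = m (h \<xi>)" for \<xi>
  have Fb: "bounded (F \<xi> y ` carrier G)" if "\<xi> \<in> linf G" "y \<in> carrier G" for \<xi> y
    using linf_bounded[OF that(1)] by (rule bounded_subset) (use that in \<open>auto simp: F_def\<close>)
  have hb: "bounded (h \<xi> ` carrier G)" if \<xi>: "\<xi> \<in> linf G" for \<xi>
  proof -
    obtain B where "\<forall>x\<in>carrier G. cmod (\<xi> x) \<le> B"
      using linf_bounded[OF \<xi>] by (auto simp: bounded_iff)
    then have "\<forall>y\<in>carrier G. cmod (h \<xi> y) \<le> B"
      unfolding h_def by (intro ballI mean_onD(3)[OF m]) (auto simp: F_def)
    then show ?thesis by (auto simp: bounded_iff)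
  qed
  have const: "m (\<lambda>_. c) = c" for c
    using mean_onD(2)[OF m, of "\<lambda>_. 1" c] mean_onD(5)[OF m] by (simp add: image_constant_conv)
  have bc: "bounded ((\<lambda>_. c :: complex) ` carrier G)" for c
    by (simp add: image_constant_conv)
  have "is_mean G M"
    unfolding is_mean_def
  proof (intro conjI ballI allI impI)
    fix \<xi> \<eta> assume \<xi>: "\<xi> \<in> linf G" and \<eta>: "\<eta> \<in> linf G"
    have "m (\<lambda>y. h \<xi> y + h \<eta> y) = M (\<lambda>x. \<xi> x + \<eta> x)"
      unfolding M_def
    proof (rule mean_on_cong[OF m bounded_fun_plus[OF hb[OF \<xi>] hb[OF \<eta>]]])
      fix y assume "y \<in> carrier G"
      then show "h \<xi> y + h \<eta> y = h (\<lambda>x. \<xi> x + \<eta> x) y"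
        using mean_onD(1)[OF m Fb[OF \<xi>] Fb[OF \<eta>]] by (simp add: h_def F_def)
    qed
    then show "M (\<lambda>x. \<xi> x + \<eta> x) = M \<xi> + M \<eta>"
      using mean_onD(1)[OF m hb[OF \<xi>] hb[OF \<eta>]] by (simp add: M_def)
  next
    fix c \<xi> assume \<xi>: "\<xi> \<in> linf G"
    have "m (\<lambda>y. c * h \<xi> y) = M (\<lambda>x. c * \<xi> x)"
      unfolding M_def
    proof (rule mean_on_cong[OF m bounded_fun_cmult[OF hb[OF \<xi>]]])
      fix y assume "y \<in> carrier G"
      then show "c * h \<xi> y = h (\<lambda>x. c * \<xi> x) y"
        using mean_onD(2)[OF m Fb[OF \<xi>]] by (simp add: h_def F_def)
    qed
    then show "M (\<lambda>x. c * \<xi> x) = c * M \<xi>"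
      using mean_onD(2)[OF m hb[OF \<xi>]] by (simp add: M_def)
  next
    fix \<xi> assume \<xi>: "\<xi> \<in> linf G" and nn: "\<forall>x\<in>carrier G. \<xi> x \<in> \<real>\<^sub>\<ge>\<^sub>0"
    have "h \<xi> y \<in> \<real>\<^sub>\<ge>\<^sub>0" if "y \<in> carrier G" for y
      unfolding h_def by (rule mean_onD(4)[OF m Fb[OF \<xi> that]]) (use nn that in \<open>auto simp: F_def\<close>)
    then show "M \<xi> \<in> \<real>\<^sub>\<ge>\<^sub>0"
      unfolding M_def by (intro mean_onD(4)[OF m hb[OF \<xi>]]) auto
  next
    let ?one = "\<lambda>x. if x \<in> carrier G then 1 else 0 :: complex"
    have "h ?one y = 1" if "y \<in> carrier G" for y
      using mean_on_cong[OF m bc[of 1], of "F ?one y"] that const[of 1] by (simp add: h_def F_def)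
    then show "M ?one = 1"
      using mean_on_cong[OF m bc[of 1], of "h ?one"] const[of 1] by (simp add: M_def)
  qed
  moreover have "\<exists>\<xi> \<in> linf G. M \<xi> \<noteq> \<xi> \<one>"
  proof
    define d where "d = (\<lambda>y x :: 'a. if x = y then 1 else 0 :: complex)"
    have db: "bounded (d y ` A)" for y A
      by (auto simp: bounded_iff d_def intro!: exI[of _ 1])
    then show "d \<one> \<in> linf G"
      by (auto simp: linf_def d_def)
    \<comment> \<open>Right translations permute the point masses, so all of them have the same
      mean.\<close>
    have md: "m (d y) = m (d \<one>)" if "y \<in> carrier G" for y
    proof -
      have "m (d y) = m (d \<one> \<circ> (\<lambda>x. x \<otimes> inv y))"
        using that by (intro mean_on_cong[OF m db]) (auto simp: d_def inv_solve_right')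
      then show ?thesis using inv[OF that db] by simp
    qed
    have "h (d \<one>) y = m (d \<one>)" if "y \<in> carrier G" for y
    proof -
      have "m (d y) = h (d \<one>) y"
        unfolding h_def using that
        by (intro mean_on_cong[OF m db]) (auto simp: d_def F_def inv_solve_left')
      then show ?thesis using md[OF that] by simp
    qed
    then have Md: "M (d \<one>) = m (d \<one>)"
      using mean_on_cong[OF m bc[of "m (d \<one>)"], of "h (d \<one>)"] const by (simp add: M_def)
    obtain g where g: "g \<in> carrier G" "g \<noteq> \<one>"
      using nontriv one_closed by blast
    \<comment> \<open>Two distinct points carry equal mass and together at most 1, so a single point
      cannot carry mass 1. This is where the group must be nontrivial.\<close>
    have "cmod (m (\<lambda>x. d \<one> x + d g x)) \<le> 1"
      by (rule mean_onD(3)[OF m]) (use g in \<open>auto simp: d_def\<close>)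
    then have "cmod (2 * m (d \<one>)) \<le> 1"
      using mean_onD(1)[OF m db db] md[OF g(1)] by simp
    then have "m (d \<one>) \<noteq> 1" by auto
    then show "M (d \<one>) \<noteq> d \<one> \<one>"
      using Md by (simp add: d_def)
  qed
  moreover have "M (conj_fun G g \<xi>) = M \<xi>" if \<xi>: "\<xi> \<in> linf G" and g: "g \<in> carrier G" for \<xi> g
  proof -
    have ig: "inv (inv g) = g" "inv g \<in> carrier G" using g by auto
    have bt: "bounded ((\<phi> \<circ> (\<lambda>x. x \<otimes> inv (inv g))) ` carrier G)" if "bounded (\<phi> ` carrier G)"
      for \<phi> :: "'a \<Rightarrow> complex"
      using that bij_betw_right_translation[OF ig(2)]
      unfolding image_comp[symmetric] bij_betw_def by simp
    \<comment> \<open>Since \<open>\<xi>\<close> is evaluated at the product of the inverse of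
      \<open>y \<otimes> g\<close> with \<open>z \<otimes> g\<close>, invariance of the inner mean
      removes \<open>g\<close> from \<open>z\<close>, and that of the outer mean then removes it
      from \<open>y\<close>. Both use the hypothesis at \<open>inv g\<close>, whence the double
      inverse.\<close>
    have "h (conj_fun G g \<xi>) y = h \<xi> (y \<otimes> g)" if y: "y \<in> carrier G" for y
    proof -
      have yg: "y \<otimes> g \<in> carrier G" using y g by simp
      have "m (F \<xi> (y \<otimes> g) \<circ> (\<lambda>x. x \<otimes> inv (inv g))) = h (conj_fun G g \<xi>) y"
        unfolding h_def
        by (rule mean_on_cong[OF m bt[OF Fb[OF \<xi> yg]]])
          (use y g in \<open>simp add: F_def conj_fun_def m_assoc inv_mult_group\<close>)
      then show ?thesis
        using inv[OF ig(2) Fb[OF \<xi> yg]] by (simp add: h_def)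
    qed
    then have "m (h \<xi> \<circ> (\<lambda>x. x \<otimes> inv (inv g))) = M (conj_fun G g \<xi>)"
      unfolding M_def using ig by (intro mean_on_cong[OF m bt[OF hb[OF \<xi>]]]) simp
    then show ?thesis
      using inv[OF ig(2) hb[OF \<xi>]] by (simp add: M_def)
  qed
  ultimately show ?thesis unfolding inner_amenable_def by blast
qed

lemma conjugation_gap:
  assumes "countable (carrier G)" "\<not> inner_amenable G"
  obtains K and \<delta> :: real where "finite K" "K \<subseteq> carrier G" "\<delta> > 0"
    "gap_on (carrier G - {\<one>}) K (\<lambda>g x. inv g \<otimes> x \<otimes> g) \<delta>"
proof (rule invariant_mean_or_gap[OF assms(1) bij_betw_conjugation])
  fix m
  assume "mean_on (carrier G - {\<one>}) m"
    and "\<And>g \<phi>. g \<in> carrier G \<Longrightarrow> bounded (\<phi> ` (carrier G - {\<one>})) \<Longrightarrow>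
      m (\<phi> \<circ> (\<lambda>x. inv g \<otimes> x \<otimes> g)) = m \<phi>"
  then show False
    using conj_invariant_mean_inner_amenable assms(2) by blast
qed (use that in blast)+

lemma right_translation_gap:
  assumes "countable (carrier G)" "\<not> inner_amenable G" "carrier G \<noteq> {\<one>}"
  obtains K and \<delta> :: real where "finite K" "K \<subseteq> carrier G" "\<delta> > 0"
    "gap_on (carrier G) K (\<lambda>g x. x \<otimes> inv g) \<delta>"
proof (rule invariant_mean_or_gap[OF assms(1) bij_betw_right_translation])
  fix m
  assume "mean_on (carrier G) m"
    and "\<And>g \<phi>. g \<in> carrier G \<Longrightarrow> bounded (\<phi> ` carrier G) \<Longrightarrow> m (\<phi> \<circ> (\<lambda>x. x \<otimes> inv g)) = m \<phi>"
  then show False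
    using right_invariant_mean_inner_amenable assms(2,3) by blast
qed (use that in blast)+

end

section \<open>The Hilbert space of the group and the diagonal embedding\<close>

definition ell2_norm_sq :: "('g, 'b) monoid_scheme \<Rightarrow> ('g \<Rightarrow> complex) \<Rightarrow> real" where
  "ell2_norm_sq G \<xi> = (\<Sum>\<^sub>\<infinity>x\<in>carrier G. (cmod (\<xi> x))\<^sup>2)"

lemma ell2_summable: "\<xi> \<in> ell2 G \<Longrightarrow> (\<lambda>x. (cmod (\<xi> x))\<^sup>2) summable_on carrier G"
  by (simp add: ell2_def)

lemma ell2_norm_sq_nonneg: "0 \<le> ell2_norm_sq G \<xi>"
  unfolding ell2_norm_sq_def by (intro infsum_nonneg) simp

lemma ell2_norm_eq: "ell2_norm G \<xi> = sqrt (ell2_norm_sq G \<xi>)"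
  by (simp add: ell2_norm_def ell2_norm_sq_def)

lemma ell2_add:
  assumes "\<xi> \<in> ell2 G" "\<eta> \<in> ell2 G"
  shows "(\<lambda>x. \<xi> x + \<eta> x) \<in> ell2 G"
proof -
  have "(\<lambda>x. (1 + 1) * (cmod (\<xi> x))\<^sup>2 + (1 + 1 / 1) * (cmod (\<eta> x))\<^sup>2) summable_on carrier G"
    by (intro summable_on_add summable_on_cmult_right ell2_summable assms)
  then have "(\<lambda>x. (cmod (\<xi> x + \<eta> x))\<^sup>2) summable_on carrier G"
    by (rule summable_on_comparison_test) (use cmod_add_sq_le[of 1] in auto)
  then show ?thesis using assms by (simp add: ell2_def)
qed

lemma ell2_cmult: "\<xi> \<in> ell2 G \<Longrightarrow> (\<lambda>x. c * \<xi> x) \<in> ell2 G"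
  by (simp add: ell2_def norm_mult power_mult_distrib summable_on_cmult_right)

lemma ell2_zero: "(\<lambda>_. 0) \<in> ell2 G"
  by (simp add: ell2_def)

lemma ell2_sum: "(\<And>i. i \<in> F \<Longrightarrow> \<xi> i \<in> ell2 G) \<Longrightarrow> (\<lambda>x. \<Sum>i\<in>F. \<xi> i x) \<in> ell2 G"
  by (induction F rule: infinite_finite_induct) (simp_all add: ell2_zero ell2_add)

lemma ell2_diff: "\<xi> \<in> ell2 G \<Longrightarrow> \<eta> \<in> ell2 G \<Longrightarrow> (\<lambda>x. \<xi> x - \<eta> x) \<in> ell2 G"
  using ell2_add[OF _ ell2_cmult[of \<eta> G "-1"]] by simp

lemma cmod_le_ell2_norm:
  assumes "\<xi> \<in> ell2 G" "x \<in> carrier G"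
  shows "cmod (\<xi> x) \<le> ell2_norm G \<xi>"
proof -
  have "(\<Sum>x\<in>{x}. (cmod (\<xi> x))\<^sup>2) \<le> ell2_norm_sq G \<xi>"
    unfolding ell2_norm_sq_def using assms by (intro finite_sum_le_infsum ell2_summable) auto
  then show ?thesis
    unfolding ell2_norm_eq using real_le_rsqrt by simp
qed

lemma infsum_sum_finite:
  fixes f :: "'j \<Rightarrow> 'x \<Rightarrow> real"
  assumes "finite J" "\<And>j. j \<in> J \<Longrightarrow> f j summable_on X"
  shows "(\<lambda>x. \<Sum>j\<in>J. f j x) summable_on X \<and> (\<Sum>\<^sub>\<infinity>x\<in>X. \<Sum>j\<in>J. f j x) = (\<Sum>j\<in>J. \<Sum>\<^sub>\<infinity>x\<in>X. f j x)"
  using assms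
proof (induction J)
  case (insert j J)
  then have IH: "(\<lambda>x. \<Sum>j\<in>J. f j x) summable_on X"
    "(\<Sum>\<^sub>\<infinity>x\<in>X. \<Sum>j\<in>J. f j x) = (\<Sum>j\<in>J. \<Sum>\<^sub>\<infinity>x\<in>X. f j x)"
    and j: "f j summable_on X" by auto
  show ?case
    using insert.hyps IH(2) summable_on_add[OF j IH(1)] infsum_add[OF j IH(1)] by simp
qed simp

definition point_mass :: "'g \<Rightarrow> 'g \<Rightarrow> complex" where
  "point_mass g = (\<lambda>x. if x = g then 1 else 0)"

lemma point_mass_ell2:
  assumes "g \<in> carrier G"
  shows "point_mass g \<in> ell2 G" "ell2_norm_sq G (point_mass g) = 1"
proof -
  have "((\<lambda>x. (cmod (point_mass g x))\<^sup>2) has_sum 1) {g}"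
    by (rule has_sum_finiteI) (auto simp: point_mass_def)
  then have "((\<lambda>x. (cmod (point_mass g x))\<^sup>2) has_sum 1) (carrier G)"
    using assms by (rule_tac has_sum_cong_neutral[THEN iffD1, rotated -1]) (auto simp: point_mass_def)
  then show "point_mass g \<in> ell2 G" "ell2_norm_sq G (point_mass g) = 1"
    using assms by (auto simp: ell2_def ell2_norm_sq_def has_sum_iff point_mass_def)
qed

lemma ell2_inner_point_mass:
  assumes "g \<in> carrier G"
  shows "ell2_inner G \<xi> (point_mass g) = \<xi> g"
proof -
  have "ell2_inner G \<xi> (point_mass g) = (\<Sum>\<^sub>\<infinity>x\<in>{g}. \<xi> x * cnj (point_mass g x))"
    unfolding ell2_inner_def by (rule infsum_cong_neutral) (use assms in \<open>auto simp: point_mass_def\<close>)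
  then show ?thesis by (simp add: point_mass_def)
qed

lemma ell2_inner_self:
  assumes "\<xi> \<in> ell2 G"
  shows "ell2_inner G \<xi> \<xi> = of_real (ell2_norm_sq G \<xi>)"
proof -
  have "((\<lambda>x. complex_of_real ((cmod (\<xi> x))\<^sup>2)) has_sum complex_of_real (ell2_norm_sq G \<xi>)) (carrier G)"
    unfolding ell2_norm_sq_def by (rule has_sum_of_real[OF has_sum_infsum[OF ell2_summable[OF assms]]])
  then show ?thesis
    unfolding ell2_inner_def complex_norm_square by (rule infsumI)
qed

lemma canonical_trace_eq: "group G \<Longrightarrow> canonical_trace G T = T (point_mass \<one>\<^bsub>G\<^esub>) \<one>\<^bsub>G\<^esub>"
  using ell2_inner_point_mass[of "\<one>\<^bsub>G\<^esub>" G] group.is_monoid[of G] monoid.one_closed[of G]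
  by (simp add: canonical_trace_def Let_def flip: point_mass_def)

context group
begin

lemma left_reg_ell2: "g \<in> carrier G \<Longrightarrow> \<xi> \<in> ell2 G \<Longrightarrow> left_reg G g \<xi> \<in> ell2 G"
  using summable_on_reindex_bij_betw[OF bij_betw_left_translation[of "inv g"], of "\<lambda>x. (cmod (\<xi> x))\<^sup>2"]
  by (auto simp: ell2_def left_reg_def cong: summable_on_cong)

lemma left_reg_point_mass:
  assumes "g \<in> carrier G" "h \<in> carrier G"
  shows "left_reg G g (point_mass h) = point_mass (g \<otimes> h)"
  using assms point_mass_ell2(1)[OF assms(2)]
  by (auto simp: left_reg_def point_mass_def fun_eq_iff inv_solve_left')

text \<open>The reduced C*-algebra commutes with right translations.\<close>

lemma reduced_cstar_point_mass:
  assumes T: "T \<in> reduced_cstar G" and g: "g \<in> carrier G" and x: "x \<in> carrier G"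
  shows "T (point_mass g) x = T (point_mass \<one>) (x \<otimes> inv g)"
proof -
  have xg: "x \<otimes> inv g \<in> carrier G" using g x by simp
  \<comment> \<open>Point values are dominated by the norm of \<open>\<ell>\<^sup>2(G)\<close>, so
    replacing \<open>T\<close> by a nearby element \<open>S\<close> of the group algebra costs at
    most \<open>\<epsilon>\<close> on each side, and for \<open>S\<close> the identity is
    exact.\<close>
  have le: "cmod (T (point_mass g) x - T (point_mass \<one>) (x \<otimes> inv g)) \<le> 0 + 2 * \<epsilon>" if "\<epsilon> > 0" for \<epsilon>
  proof -
    from T that obtain S where S: "S \<in> group_algebra_ops G"
      and close: "\<And>\<xi>. \<xi> \<in> ell2 G \<Longrightarrow> ell2_norm G (\<lambda>x. T \<xi> x - S \<xi> x) \<le> \<epsilon> * ell2_norm G \<xi>"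
      unfolding reduced_cstar_def by blast
    obtain F c where F: "finite F" "F \<subseteq> carrier G" and Sdef: "S = (\<lambda>\<xi> x. \<Sum>g\<in>F. c g * left_reg G g \<xi> x)"
      using S unfolding group_algebra_ops_def by blast
    have near: "cmod (T (point_mass h) y - S (point_mass h) y) \<le> \<epsilon>"
      if h: "h \<in> carrier G" and y: "y \<in> carrier G" for h y
    proof -
      note pm = point_mass_ell2[OF h]
      have "T (point_mass h) \<in> ell2 G"
        using T pm by (simp add: reduced_cstar_def bounded_op_def)
      moreover have "S (point_mass h) \<in> ell2 G"
        unfolding Sdef using F pm by (intro ell2_sum ell2_cmult left_reg_ell2) auto
      ultimately have "(\<lambda>x. T (point_mass h) x - S (point_mass h) x) \<in> ell2 G"
        by (rule ell2_diff)
      from cmod_le_ell2_norm[OF this y] close[OF pm(1)] pm(2) show ?thesis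
        by (simp add: ell2_norm_eq)
    qed
    have "S (point_mass g) x = S (point_mass \<one>) (x \<otimes> inv g)"
      unfolding Sdef
    proof (rule sum.cong[OF refl])
      fix h assume "h \<in> F"
      then have h: "h \<in> carrier G" using F by auto
      have "x = h \<otimes> g \<longleftrightarrow> x \<otimes> inv g = h"
        using g h x by (simp add: inv_solve_right')
      then show "c h * left_reg G h (point_mass g) x = c h * left_reg G h (point_mass \<one>) (x \<otimes> inv g)"
        using g h by (simp add: left_reg_point_mass) (simp add: point_mass_def)
    qed
    then have "T (point_mass g) x - T (point_mass \<one>) (x \<otimes> inv g)
        = (T (point_mass g) x - S (point_mass g) x)
          - (T (point_mass \<one>) (x \<otimes> inv g) - S (point_mass \<one>) (x \<otimes> inv g))"
      by simp
    also have "cmod \<dots> \<le> \<epsilon> + \<epsilon>"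
      using norm_triangle_ineq4 near[OF g x] near[OF one_closed xg] by (meson add_mono order_trans)
    finally show ?thesis by simp
  qed
  have "cmod (T (point_mass g) x - T (point_mass \<one>) (x \<otimes> inv g)) \<le> 0"
    by (rule field_le_epsilon) (use le[of "e / 2" for e] in simp)
  then show ?thesis by simp
qed

end

section \<open>Matrix stages of the direct limit\<close>

lemma mat_star_hom_diff:
  assumes "mat_star_hom k \<phi>" "a \<in> carrier_mat k k" "b \<in> carrier_mat k k"
  shows "\<phi> (a - b) = \<phi> a - \<phi> b"
proof -
  have "a - b + b = a"
    using assms by (intro eq_matI) auto
  moreover have "\<phi> (a - b + b) = \<phi> (a - b) + \<phi> b"
    using assms minus_carrier_mat[OF assms(3), of a] by (simp add: mat_star_hom_def)
  ultimately show ?thesis by (simp add: algebra_simps)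
qed

lemma dad_size_pos: "0 < dad_size n i"
  by (simp add: dad_size_def)

lemma dad_size_Suc: "dad_size n (Suc i) = dad_size n i + dad_size n i * n i"
  by (simp add: dad_size_def)

definition dad_diag :: "(nat \<Rightarrow> nat) \<Rightarrow> (nat \<Rightarrow> 'd::cstar_algebra \<Rightarrow> complex mat) \<Rightarrow> nat \<Rightarrow> 'd \<Rightarrow> 'd mat" where
  "dad_diag n \<pi> i d = connecting (dad_map n \<pi>) 0 i (mat 1 1 (\<lambda>_. d))"

lemma dad_map_carrier:
  "a \<in> carrier_mat (dad_size n i) (dad_size n i) \<Longrightarrow>
    dad_map n \<pi> i a \<in> carrier_mat (dad_size n (Suc i)) (dad_size n (Suc i))"
  unfolding dad_map_def Let_def dad_size_Suc
  by (rule four_block_carrier_mat) (auto simp: entrywise_rep_def)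

lemma dad_diag_carrier: "dad_diag n \<pi> i d \<in> carrier_mat (dad_size n i) (dad_size n i)"
proof (induction i)
  case 0
  then show ?case by (simp add: dad_diag_def dad_size_def)
next
  case (Suc i)
  then show ?case using dad_map_carrier by (simp add: dad_diag_def)
qed

lemma dad_diag_Suc_index:
  assumes "j < dad_size n (Suc i)" "l < dad_size n (Suc i)"
  shows "dad_diag n \<pi> (Suc i) d $$ (j, l) =
    (if j < dad_size n i then if l < dad_size n i then dad_diag n \<pi> i d $$ (j, l) else 0
     else if l < dad_size n i then 0
     else entrywise_rep (dad_size n i) (n i) (\<pi> i) (dad_diag n \<pi> i d) $$ (j - dad_size n i, l - dad_size n i))"
  using assms dad_diag_carrier[of n \<pi> i d]
  by (auto simp: dad_diag_def dad_map_def Let_def dad_size_Suc entrywise_rep_def)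

text \<open>In \<open>M\<^bsub>k i\<^esub>(D)\<close> an element of \<open>D\<close> becomes \<open>diag(d, \<sigma>(d))\<close> with a scalar matrix \<open>\<sigma>(d)\<close>.\<close>

lemma dad_diag_index:
  fixes d :: "'d::cstar_algebra"
  shows "dad_diag n \<pi> i d $$ (0, 0) = d"
    and "0 < j \<Longrightarrow> j < dad_size n i \<Longrightarrow> dad_diag n \<pi> i d $$ (j, 0) = 0 \<and> dad_diag n \<pi> i d $$ (0, j) = 0"
    and "0 < j \<Longrightarrow> j < dad_size n i \<Longrightarrow> 0 < l \<Longrightarrow> l < dad_size n i \<Longrightarrow>
      \<exists>c. dad_diag n \<pi> i d $$ (j, l) = c *\<^sub>C 1"
proof (induction i arbitrary: j l)
  case 0
  { case 1 then show ?case by (simp add: dad_diag_def) }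
  { case 2 then show ?case by (simp add: dad_size_def) }
  { case 3 then show ?case by (simp add: dad_size_def) }
next
  case (Suc i)
  have p: "0 < dad_size n i" "0 < dad_size n (Suc i)" by (rule dad_size_pos)+
  \<comment> \<open>Entries in the off-diagonal zero blocks count as the scalar 0.\<close>
  have z: "0 = (0::complex) *\<^sub>C (1::'d)"
    using scaleC_of_real[of 0 "1::'d"] by simp
  { case 1 then show ?case using p Suc.IH(1) by (simp add: dad_diag_Suc_index) }
  { case 2 then show ?case using p Suc.IH(2) by (simp add: dad_diag_Suc_index) }
  { case 3
    then show ?case
      using p Suc.IH(3)[of j l] z by (auto simp: dad_diag_Suc_index entrywise_rep_def dad_size_Suc) }
qed

lemma mult_index_col0:
  assumes "a \<in> carrier_mat k k" "b \<in> carrier_mat k k" "j < k"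
  shows "(a * b) $$ (j, 0) = (\<Sum>l<k. a $$ (j, l) * b $$ (l, 0))"
  using assms by (auto simp: scalar_prod_def lessThan_atLeast0)

lemma sum_lessThan_split_first:
  fixes f :: "nat \<Rightarrow> 'c::comm_monoid_add"
  assumes "0 < k"
  shows "(\<Sum>j<k. f j) = f 0 + (\<Sum>j\<in>{1..<k}. f j)"
  using assms by (simp add: lessThan_atLeast0 sum.atLeast_Suc_lessThan)

section \<open>GNS vectors and the state on the matrix stages\<close>

locale dadarlat_state = group G
  for G :: "('g, 'b) monoid_scheme" (structure) +
  fixes \<theta> :: "'d::cstar_algebra \<Rightarrow> 'g op"
    and n :: "nat \<Rightarrow> nat"
    and \<pi> :: "nat \<Rightarrow> 'd \<Rightarrow> complex mat"
    and \<mu> :: "nat \<Rightarrow> 'd mat \<Rightarrow> 'a::cstar_algebra"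
    and \<rho> :: "'a \<Rightarrow> complex"
    and lft :: "'g \<Rightarrow> 'd"
  assumes surj: "surj_star_hom_reduced G \<theta>"
    and limit: "dadarlat_limit n \<pi> \<mu>"
    and rho: "is_rho_theta G \<theta> n \<mu> \<rho>"
    and lift: "\<And>g. g \<in> carrier G \<Longrightarrow> norm (lft g) = 1 \<and> \<theta> (lft g) = left_reg G g"
begin

text \<open>The GNS map of the trace pulled back along \<open>\<theta>\<close>: the image of the
  cyclic vector, whose value at \<one> is the trace of \<open>\<theta> d\<close>.\<close>

definition vec_of :: "'d \<Rightarrow> 'g \<Rightarrow> complex" where
  "vec_of d = \<theta> d (point_mass \<one>)"

lemma theta_reduced: "\<theta> d \<in> reduced_cstar G"
  using surj unfolding surj_star_hom_reduced_def by blast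

lemma theta_ell2: "\<xi> \<in> ell2 G \<Longrightarrow> \<theta> d \<xi> \<in> ell2 G"
  using theta_reduced[of d] by (simp add: reduced_cstar_def bounded_op_def)

lemma vec_of_ell2: "vec_of d \<in> ell2 G"
  unfolding vec_of_def by (intro theta_ell2 point_mass_ell2 one_closed)

lemma vec_of_add: "vec_of (a + b) x = vec_of a x + vec_of b x"
  using surj by (simp add: surj_star_hom_reduced_def vec_of_def)

lemma vec_of_scaleC: "vec_of (c *\<^sub>C a) x = c * vec_of a x"
  using surj by (simp add: surj_star_hom_reduced_def vec_of_def)

lemma vec_of_mult: "vec_of (a * b) = \<theta> a (vec_of b)"
  using surj by (simp add: surj_star_hom_reduced_def vec_of_def)

lemma vec_of_zero [simp]: "vec_of 0 x = 0"
  using vec_of_add[of 0 0 x] by simp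

lemma vec_of_diff: "vec_of (a - b) x = vec_of a x - vec_of b x"
  using vec_of_add[of "a - b" b x] by simp

lemma vec_of_sum: "vec_of (\<Sum>i\<in>I. f i) x = (\<Sum>i\<in>I. vec_of (f i) x)"
  by (induction I rule: infinite_finite_induct) (simp_all add: vec_of_add)

text \<open>Unitality is not a clause of \<open>surj_star_hom_reduced\<close>. The lift of the
  neutral element provides it on the cyclic vector: \<open>\<theta> (lft \<one>)\<close> fixes that
  vector, and \<open>1 * lft \<one> = lft \<one>\<close>.\<close>

lemma vec_of_one: "vec_of 1 = point_mass \<one>"
proof -
  have id: "\<theta> (lft \<one>) (point_mass \<one>) = point_mass \<one>"
    using lift[OF one_closed] left_reg_point_mass[OF one_closed one_closed] by simp
  have "\<theta> (1 * lft \<one>) = \<theta> 1 \<circ> \<theta> (lft \<one>)"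
    using surj unfolding surj_star_hom_reduced_def by blast
  then show ?thesis
    using id by (metis comp_apply mult_1 vec_of_def)
qed

lemma vec_of_lift_mult:
  assumes "g \<in> carrier G" "x \<in> carrier G"
  shows "vec_of (lft g * d) x = vec_of d (inv g \<otimes> x)"
  using assms lift[OF assms(1)] vec_of_ell2[of d] by (simp add: vec_of_mult left_reg_def)

text \<open>The lift sends the cyclic vector to the point mass at \<open>g\<close>, and
  \<open>\<theta> d\<close> commutes with right translations. So multiplication by a lift is an
  exact translation on either side.\<close>

lemma vec_of_mult_lift:
  assumes "g \<in> carrier G" "x \<in> carrier G"
  shows "vec_of (d * lft g) x = vec_of d (x \<otimes> inv g)"
proof -
  have "vec_of (lft g) = point_mass g"
    using lift[OF assms(1)] left_reg_point_mass[OF assms(1) one_closed] assms(1) by (simp add: vec_of_def)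
  then show ?thesis
    using reduced_cstar_point_mass[OF theta_reduced assms] by (simp add: vec_of_mult) (simp add: vec_of_def)
qed

text \<open>The GNS identity: the adjoint clause for \<open>\<theta>\<close> moves
  \<open>star b\<close> across the inner product.\<close>

lemma vec_of_star_mult: "vec_of (star b * b) \<one> = of_real (ell2_norm_sq G (vec_of b))"
proof -
  have adj: "ell2_inner G (\<theta> a \<xi>) \<eta> = ell2_inner G \<xi> (\<theta> (star a) \<eta>)"
    if "\<xi> \<in> ell2 G" "\<eta> \<in> ell2 G" for a \<xi> \<eta>
    using surj that unfolding surj_star_hom_reduced_def by blast
  have "vec_of (star b * b) \<one> = ell2_inner G (\<theta> (star b) (vec_of b)) (point_mass \<one>)"
    by (simp add: ell2_inner_point_mass vec_of_mult)
  also have "\<dots> = ell2_inner G (vec_of b) (vec_of b)"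
    by (simp add: adj vec_of_ell2 point_mass_ell2(1) star_star vec_of_def[symmetric])
  finally show ?thesis by (simp add: ell2_inner_self vec_of_ell2)
qed

lemma state: "is_state \<rho>"
  using rho by (simp add: is_rho_theta_def)

abbreviation sz :: "nat \<Rightarrow> nat" where "sz \<equiv> dad_size n"
abbreviation dg :: "nat \<Rightarrow> 'd \<Rightarrow> 'd mat" where "dg \<equiv> dad_diag n \<pi>"
abbreviation \<iota> :: "'d \<Rightarrow> 'a" where "\<iota> \<equiv> dad_embed \<mu>"

lemma mu_hom: "mat_star_hom (sz i) (\<mu> i)"
  using limit by (simp add: dadarlat_limit_def cstar_direct_limit_def)

lemma mu_dense: "closure (\<Union>i. \<mu> i ` carrier_mat (sz i) (sz i)) = UNIV"
  using limit by (simp add: dadarlat_limit_def cstar_direct_limit_def)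

lemma mu_mult: "a \<in> carrier_mat (sz i) (sz i) \<Longrightarrow> b \<in> carrier_mat (sz i) (sz i) \<Longrightarrow> \<mu> i (a * b) = \<mu> i a * \<mu> i b"
  using mu_hom[of i] by (simp add: mat_star_hom_def)

text \<open>An embedded element of \<open>D\<close> is visible at every stage, so its products with
  \<open>\<mu> i a\<close> can be computed among matrices of one size.\<close>

lemma mu_diag: "\<mu> i (dg i d) = \<iota> d"
proof (induction i)
  case 0
  then show ?case by (simp add: dad_diag_def dad_embed_def)
next
  case (Suc i)
  have "\<mu> (Suc i) (dad_map n \<pi> i (dg i d)) = \<mu> i (dg i d)"
    using limit dad_diag_carrier[of n \<pi> i d] by (simp add: dadarlat_limit_def cstar_direct_limit_def)
  then show ?case using Suc by (simp add: dad_diag_def)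
qed

lemma embed_hom:
  shows "\<iota> (x + y) = \<iota> x + \<iota> y" "\<iota> (c *\<^sub>C x) = c *\<^sub>C \<iota> x" "\<iota> (x * y) = \<iota> x * \<iota> y"
    "\<iota> (star x) = star (\<iota> x)" "\<iota> 1 = 1"
proof -
  have h: "mat_star_hom 1 (\<mu> 0)" using mu_hom[of 0] by (simp add: dad_size_def)
  let ?m = "\<lambda>d :: 'd. mat 1 1 (\<lambda>_. d)"
  have c: "?m d \<in> carrier_mat 1 1" for d by simp
  have "?m (x + y) = ?m x + ?m y" "?m (c *\<^sub>C x) = map_mat (scaleC c) (?m x)"
    "?m (x * y) = ?m x * ?m y" "?m (star x) = mat_star (?m x)" "?m 1 = 1\<^sub>m 1"
    by (auto intro!: eq_matI simp: mat_star_def scalar_prod_def)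
  then show "\<iota> (x + y) = \<iota> x + \<iota> y" "\<iota> (c *\<^sub>C x) = c *\<^sub>C \<iota> x" "\<iota> (x * y) = \<iota> x * \<iota> y"
    "\<iota> (star x) = star (\<iota> x)" "\<iota> 1 = 1"
    using h c unfolding mat_star_hom_def dad_embed_def by metis+
qed

lemma rho_mu: "a \<in> carrier_mat (sz i) (sz i) \<Longrightarrow> \<rho> (\<mu> i a) = vec_of (a $$ (0, 0)) \<one>"
  using rho canonical_trace_eq[OF is_group] by (simp add: is_rho_theta_def vec_of_def)

text \<open>The state reads only the corner entry, and the corner of \<open>mat_star a * a\<close>
  involves only the first column of \<open>a\<close>. The GNS seminorm at stage \<open>i\<close> is
  thus that of a direct sum of \<open>sz i\<close> copies of
  \<open>\<ell>\<^sup>2(G)\<close>.\<close>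

lemma state_sq_mu:
  assumes a: "a \<in> carrier_mat (sz i) (sz i)"
  shows "state_sq \<rho> (\<mu> i a) = (\<Sum>j<sz i. ell2_norm_sq G (vec_of (a $$ (j, 0))))"
proof -
  have sa: "mat_star a \<in> carrier_mat (sz i) (sz i)"
    using a by (simp add: mat_star_def)
  have "star (\<mu> i a) * \<mu> i a = \<mu> i (mat_star a * a)"
    using mu_hom[of i] a sa by (simp add: mat_star_hom_def)
  moreover have "(mat_star a * a) $$ (0, 0) = (\<Sum>j<sz i. star (a $$ (j, 0)) * a $$ (j, 0))"
    using a dad_size_pos[of n i] by (auto simp: mat_star_def scalar_prod_def lessThan_atLeast0)
  ultimately have "\<rho> (star (\<mu> i a) * \<mu> i a) = (\<Sum>j<sz i. of_real (ell2_norm_sq G (vec_of (a $$ (j, 0)))))"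
    using rho_mu[of "mat_star a * a" i] a sa by (simp add: vec_of_sum vec_of_star_mult)
  then show ?thesis by (simp add: state_sq_def)
qed

lemma diag_mult_col0:
  assumes b: "b \<in> carrier_mat (sz i) (sz i)"
    and \<sigma>: "\<forall>j\<in>{1..<sz i}. \<forall>l\<in>{1..<sz i}. dg i d $$ (j, l) = \<sigma> j l *\<^sub>C 1"
  shows "(dg i d * b) $$ (0, 0) = d * b $$ (0, 0)"
    and "j \<in> {1..<sz i} \<Longrightarrow> (dg i d * b) $$ (j, 0) = (\<Sum>l\<in>{1..<sz i}. \<sigma> j l *\<^sub>C (b $$ (l, 0)))"
proof -
  note c = dad_diag_carrier[of n \<pi> i d] and p = dad_size_pos[of n i]
  note ix = dad_diag_index[where n = n and \<pi> = \<pi> and i = i and d = d]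
  show "(dg i d * b) $$ (0, 0) = d * b $$ (0, 0)"
    using ix(2) by (simp add: mult_index_col0[OF c b p] sum_lessThan_split_first[OF p] ix(1))
  assume j: "j \<in> {1..<sz i}"
  then have "j < sz i" by simp
  then show "(dg i d * b) $$ (j, 0) = (\<Sum>l\<in>{1..<sz i}. \<sigma> j l *\<^sub>C (b $$ (l, 0)))"
    using j ix(2)[of j] \<sigma>
    by (simp add: mult_index_col0[OF c b] sum_lessThan_split_first[OF p] mult_scaleC_left)
qed

text \<open>
  The scalar block of a contraction in \<open>D\<close> is contractive: apply the state to \<open>\<iota>(d) b\<close>, where \<open>b\<close> is the
  matrix with first column \<open>(0, w)\<close> and zeros elsewhere.
\<close>

lemma diag_scalars_contractive:
  assumes d: "norm d \<le> 1"
    and \<sigma>: "\<forall>j\<in>{1..<sz i}. \<forall>l\<in>{1..<sz i}. dg i d $$ (j, l) = \<sigma> j l *\<^sub>C 1"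
  shows "(\<Sum>j\<in>{1..<sz i}. (cmod (\<Sum>l\<in>{1..<sz i}. \<sigma> j l * w l))\<^sup>2) \<le> (\<Sum>l\<in>{1..<sz i}. (cmod (w l))\<^sup>2)"
proof -
  define b where "b = mat (sz i) (sz i) (\<lambda>(j, l). if l = 0 \<and> 0 < j then w j *\<^sub>C (1::'d) else 0)"
  have b: "b \<in> carrier_mat (sz i) (sz i)" by (simp add: b_def)
  note c = dad_diag_carrier[of n \<pi> i d] and p = dad_size_pos[of n i]
  have bj: "b $$ (j, 0) = w j *\<^sub>C 1" if "j \<in> {1..<sz i}" for j
    using that by (simp add: b_def)
  have b0: "b $$ (0, 0) = 0" using p by (simp add: b_def)
  have nsc: "ell2_norm_sq G (vec_of (z *\<^sub>C 1)) = (cmod z)\<^sup>2" for z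
  proof -
    have "ell2_norm_sq G (vec_of (z *\<^sub>C 1)) = (cmod z)\<^sup>2 * ell2_norm_sq G (point_mass \<one>)"
      by (simp add: ell2_norm_sq_def vec_of_scaleC vec_of_one norm_mult power_mult_distrib infsum_cmult_right')
    then show ?thesis by (simp add: point_mass_ell2(2))
  qed
  have n0: "ell2_norm_sq G (vec_of 0) = 0" by (simp add: ell2_norm_sq_def)
  have Qb: "state_sq \<rho> (\<mu> i b) = (\<Sum>l\<in>{1..<sz i}. (cmod (w l))\<^sup>2)"
    unfolding state_sq_mu[OF b] sum_lessThan_split_first[OF p] by (simp add: b0 bj n0 nsc)
  have "(dg i d * b) $$ (j, 0) = (\<Sum>l\<in>{1..<sz i}. \<sigma> j l * w l) *\<^sub>C 1" if j: "j \<in> {1..<sz i}" for j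
  proof -
    have "(\<Sum>l\<in>L. f l *\<^sub>C (1::'d)) = (\<Sum>l\<in>L. f l) *\<^sub>C 1" if "finite L" for f and L :: "nat set"
      using that by (induction L) (simp_all add: scaleC_add_left, metis scaleC_of_real of_real_0 scaleR_zero_left)
    then show ?thesis
      using diag_mult_col0(2)[OF b \<sigma> j] by (simp add: bj scaleC_scaleC)
  qed
  then have "state_sq \<rho> (\<mu> i (dg i d * b)) = (\<Sum>j\<in>{1..<sz i}. (cmod (\<Sum>l\<in>{1..<sz i}. \<sigma> j l * w l))\<^sup>2)"
    unfolding state_sq_mu[OF mult_carrier_mat[OF c b]] sum_lessThan_split_first[OF p]
    using diag_mult_col0(1)[OF b \<sigma>] by (simp add: b0 n0 nsc)
  moreover have "state_sq \<rho> (\<mu> i (dg i d * b)) = state_sq \<rho> (\<iota> d * \<mu> i b)"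
    by (simp add: mu_mult[OF c b] mu_diag)
  ultimately show ?thesis
    using state_sq_mult_le[OF state embed_hom d, of "\<mu> i b"] Qb by simp
qed

subsection \<open>Almost commuting elements\<close>

text \<open>The first column of \<open>dg i (lft g)\<close> vanishes below the corner, so right
  multiplication translates every vector by \<open>g\<close>. Left multiplication translates only
  the corner vector; on the others it acts by scalars across the indices. This asymmetry produces
  the two kinds of invariance.\<close>

lemma commutator_col0:
  fixes i a g
  defines "X \<equiv> a * dg i (lft g) - dg i (lft g) * a"
  assumes a: "a \<in> carrier_mat (sz i) (sz i)" and g: "g \<in> carrier G"
    and \<sigma>: "\<forall>j\<in>{1..<sz i}. \<forall>l\<in>{1..<sz i}. dg i (lft g) $$ (j, l) = \<sigma> j l *\<^sub>C 1"
  shows "X \<in> carrier_mat (sz i) (sz i)"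
    and "\<mu> i X = \<mu> i a * \<iota> (lft g) - \<iota> (lft g) * \<mu> i a"
    and "x \<in> carrier G \<Longrightarrow>
      vec_of (X $$ (0, 0)) x = vec_of (a $$ (0, 0)) (x \<otimes> inv g) - vec_of (a $$ (0, 0)) (inv g \<otimes> x)"
    and "x \<in> carrier G \<Longrightarrow> j \<in> {1..<sz i} \<Longrightarrow>
      vec_of (X $$ (j, 0)) x = vec_of (a $$ (j, 0)) (x \<otimes> inv g) - (\<Sum>l\<in>{1..<sz i}. \<sigma> j l * vec_of (a $$ (l, 0)) x)"
proof -
  note c = dad_diag_carrier[of n \<pi> i "lft g"] and p = dad_size_pos[of n i]
  note ac = mult_carrier_mat[OF a c] and ca = mult_carrier_mat[OF c a]
  note ix = dad_diag_index[where n = n and \<pi> = \<pi> and i = i and d = "lft g"]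
  show X: "X \<in> carrier_mat (sz i) (sz i)"
    unfolding X_def using ca by (rule minus_carrier_mat)
  show "\<mu> i X = \<mu> i a * \<iota> (lft g) - \<iota> (lft g) * \<mu> i a"
    unfolding X_def by (simp add: mat_star_hom_diff[OF mu_hom ac ca] mu_mult[OF a c] mu_mult[OF c a] mu_diag)
  have ad: "(a * dg i (lft g)) $$ (j, 0) = a $$ (j, 0) * lft g" if "j < sz i" for j
    using ix(2) by (simp add: mult_index_col0[OF a c that] sum_lessThan_split_first[OF p] ix(1))
  have Xj: "X $$ (j, 0) = a $$ (j, 0) * lft g - (dg i (lft g) * a) $$ (j, 0)" if "j < sz i" for j
  proof -
    have "X $$ (j, 0) = (a * dg i (lft g)) $$ (j, 0) - (dg i (lft g) * a) $$ (j, 0)"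
      unfolding X_def using carrier_matD[OF ca] that p by (intro index_minus_mat(1)) metis+
    then show ?thesis unfolding ad[OF that] .
  qed
  have d0: "(dg i (lft g) * a) $$ (0, 0) = lft g * a $$ (0, 0)"
    by (rule diag_mult_col0(1)[OF a \<sigma>])
  have dj: "(dg i (lft g) * a) $$ (j, 0) = (\<Sum>l\<in>{1..<sz i}. \<sigma> j l *\<^sub>C (a $$ (l, 0)))"
    if "j \<in> {1..<sz i}" for j
    by (rule diag_mult_col0(2)[OF a \<sigma> that])
  show "vec_of (X $$ (0, 0)) x = vec_of (a $$ (0, 0)) (x \<otimes> inv g) - vec_of (a $$ (0, 0)) (inv g \<otimes> x)"
    if "x \<in> carrier G"
    unfolding Xj[OF p] d0 using that g by (simp add: vec_of_diff vec_of_lift_mult vec_of_mult_lift)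
  show "vec_of (X $$ (j, 0)) x = vec_of (a $$ (j, 0)) (x \<otimes> inv g) - (\<Sum>l\<in>{1..<sz i}. \<sigma> j l * vec_of (a $$ (l, 0)) x)"
    if "x \<in> carrier G" "j \<in> {1..<sz i}"
  proof -
    have "j < sz i" using that(2) by simp
    then show ?thesis
      unfolding Xj[OF \<open>j < sz i\<close>] dj[OF that(2)] using that(1) g
      by (simp add: vec_of_diff vec_of_mult_lift vec_of_sum vec_of_scaleC)
  qed
qed

text \<open>
  The first column of \<open>a\<close> gives vectors \<open>V j\<close> in \<open>\<ell>\<^sup>2(G)\<close>. Almost commutation with the lift of \<open>u\<^sub>g\<close> makes
  \<open>V 0\<close> almost invariant under conjugation, and \<open>(V j)\<^sub>j\<^sub>\<ge>\<^sub>1\<close> under right translation up to a contraction.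
\<close>

lemma commutator_increments:
  fixes i a g t R
  defines "V \<equiv> \<lambda>j. vec_of (a $$ (j, 0))"
  assumes a: "a \<in> carrier_mat (sz i) (sz i)" and g: "g \<in> carrier G" and t: "0 < t"
    and R: "state_sq \<rho> (\<mu> i a * \<iota> (lft g) - \<iota> (lft g) * \<mu> i a) \<le> R"
  defines "D \<equiv> 2 * (t * state_sq \<rho> (\<mu> i a) + (1 + 1 / t) * R)"
  shows "(\<Sum>\<^sub>\<infinity>x\<in>carrier G - {\<one>}. \<bar>(cmod (V 0 (inv g \<otimes> x \<otimes> g)))\<^sup>2 - (cmod (V 0 x))\<^sup>2\<bar>) \<le> D"
    and "(\<Sum>\<^sub>\<infinity>x\<in>carrier G. \<bar>(\<Sum>j\<in>{1..<sz i}. (cmod (V j (x \<otimes> inv g)))\<^sup>2) - (\<Sum>j\<in>{1..<sz i}. (cmod (V j x))\<^sup>2)\<bar>) \<le> D"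
proof -
  have "\<exists>c. dg i (lft g) $$ (j, l) = c *\<^sub>C 1" if "j \<in> {1..<sz i}" "l \<in> {1..<sz i}" for j l
    using that by (intro dad_diag_index(3)) simp_all
  then obtain \<sigma> where \<sigma>: "\<forall>j\<in>{1..<sz i}. \<forall>l\<in>{1..<sz i}. dg i (lft g) $$ (j, l) = \<sigma> j l *\<^sub>C 1"
    by metis
  define X where "X = a * dg i (lft g) - dg i (lft g) * a"
  define E where "E j = vec_of (X $$ (j, 0))" for j
  note X = commutator_col0[OF a g \<sigma>, folded X_def]
  have p: "0 < sz i" by (rule dad_size_pos)
  have V2: "V j \<in> ell2 G" and E2: "E j \<in> ell2 G" for j
    by (simp_all add: V_def E_def vec_of_ell2)
  have QV: "state_sq \<rho> (\<mu> i a) = ell2_norm_sq G (V 0) + (\<Sum>j\<in>{1..<sz i}. ell2_norm_sq G (V j))"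
    using state_sq_mu[OF a] by (simp add: V_def sum_lessThan_split_first[OF p])
  have QE: "ell2_norm_sq G (E 0) + (\<Sum>j\<in>{1..<sz i}. ell2_norm_sq G (E j)) \<le> R"
    using state_sq_mu[OF X(1)] R unfolding X(2)[symmetric]
    by (simp add: E_def sum_lessThan_split_first[OF p])
  have nnV: "0 \<le> (\<Sum>j\<in>{1..<sz i}. ell2_norm_sq G (V j))" and nnE: "0 \<le> (\<Sum>j\<in>{1..<sz i}. ell2_norm_sq G (E j))"
    by (simp_all add: sum_nonneg ell2_norm_sq_nonneg)
  have D: "2 * (t * P + (1 + 1 / t) * Q) \<le> D" if "P \<le> state_sq \<rho> (\<mu> i a)" "Q \<le> R" for P Q
    unfolding D_def using that t by (intro mult_left_mono add_mono) auto

  let ?X = "carrier G - {\<one>}"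
  let ?q = "\<lambda>z. (cmod (E 0 (z \<otimes> g)))\<^sup>2"
  have gg: "bij_betw (\<lambda>x. x \<otimes> g) (carrier G) (carrier G)"
    using bij_betw_right_translation[of "inv g"] g by simp
  have qs: "?q summable_on carrier G" and qe: "(\<Sum>\<^sub>\<infinity>z\<in>carrier G. ?q z) = ell2_norm_sq G (E 0)"
    using summable_on_reindex_bij_betw[OF gg, of "\<lambda>x. (cmod (E 0 x))\<^sup>2"] ell2_summable[OF E2, of 0]
      infsum_reindex_bij_betw[OF gg, of "\<lambda>x. (cmod (E 0 x))\<^sup>2"]
    by (simp_all add: ell2_norm_sq_def)
  have qX: "?q summable_on ?X" and pX: "(\<lambda>x. (cmod (V 0 x))\<^sup>2) summable_on ?X"
    using qs ell2_summable[OF V2, of 0] by (auto elim: summable_on_subset_banach)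
  have "(\<Sum>\<^sub>\<infinity>x\<in>?X. \<bar>(cmod (V 0 (inv g \<otimes> x \<otimes> g)))\<^sup>2 - (cmod (V 0 x))\<^sup>2\<bar>)
      \<le> 2 * (t * (\<Sum>\<^sub>\<infinity>x\<in>?X. (cmod (V 0 x))\<^sup>2) + (1 + 1 / t) * (\<Sum>\<^sub>\<infinity>x\<in>?X. ?q x))"
  proof (rule infsum_abs_increment_le[OF bij_betw_conjugation[OF g] _ pX _ qX])
    fix x assume x: "x \<in> ?X"
    \<comment> \<open>Evaluating the commutator at \<open>x \<otimes> g\<close> instead of
      \<open>x\<close> turns a right translation compared with a left one into a
      conjugation.\<close>
    have "E 0 (x \<otimes> g) = V 0 x - V 0 (inv g \<otimes> x \<otimes> g)"
      using x g X(3)[of "x \<otimes> g"] by (simp add: E_def V_def m_assoc)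
    then have "(cmod (V 0 (inv g \<otimes> x \<otimes> g)))\<^sup>2 = (cmod (V 0 x + - E 0 (x \<otimes> g)))\<^sup>2"
      by simp
    also have "\<dots> \<le> (1 + t) * (cmod (V 0 x))\<^sup>2 + (1 + 1 / t) * (cmod (- E 0 (x \<otimes> g)))\<^sup>2"
      by (rule cmod_add_sq_le[OF t])
    finally show "(cmod (V 0 (inv g \<otimes> x \<otimes> g)))\<^sup>2 \<le> (1 + t) * (cmod (V 0 x))\<^sup>2 + (1 + 1 / t) * ?q x"
      by simp
  qed (use t in auto)
  also have "\<dots> \<le> D"
  proof (rule D)
    have "(\<Sum>\<^sub>\<infinity>x\<in>?X. (cmod (V 0 x))\<^sup>2) \<le> ell2_norm_sq G (V 0)"
      unfolding ell2_norm_sq_def by (rule infsum_mono2[OF pX ell2_summable[OF V2]]) auto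
    then show "(\<Sum>\<^sub>\<infinity>x\<in>?X. (cmod (V 0 x))\<^sup>2) \<le> state_sq \<rho> (\<mu> i a)"
      using QV nnV by linarith
    have "(\<Sum>\<^sub>\<infinity>x\<in>?X. ?q x) \<le> ell2_norm_sq G (E 0)"
      unfolding qe[symmetric] by (rule infsum_mono2[OF qX qs]) auto
    then show "(\<Sum>\<^sub>\<infinity>x\<in>?X. ?q x) \<le> R"
      using QE nnE by linarith
  qed
  finally show "(\<Sum>\<^sub>\<infinity>x\<in>?X. \<bar>(cmod (V 0 (inv g \<otimes> x \<otimes> g)))\<^sup>2 - (cmod (V 0 x))\<^sup>2\<bar>) \<le> D" .

  let ?p = "\<lambda>x. \<Sum>j\<in>{1..<sz i}. (cmod (V j x))\<^sup>2"
  let ?r = "\<lambda>x. \<Sum>j\<in>{1..<sz i}. (cmod (E j x))\<^sup>2"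
  have ps: "?p summable_on carrier G" "(\<Sum>\<^sub>\<infinity>x\<in>carrier G. ?p x) = (\<Sum>j\<in>{1..<sz i}. ell2_norm_sq G (V j))"
    using infsum_sum_finite[of "{1..<sz i}" "\<lambda>j x. (cmod (V j x))\<^sup>2" "carrier G"] ell2_summable[OF V2]
    by (simp_all add: ell2_norm_sq_def)
  have rs: "?r summable_on carrier G" "(\<Sum>\<^sub>\<infinity>x\<in>carrier G. ?r x) = (\<Sum>j\<in>{1..<sz i}. ell2_norm_sq G (E j))"
    using infsum_sum_finite[of "{1..<sz i}" "\<lambda>j x. (cmod (E j x))\<^sup>2" "carrier G"] ell2_summable[OF E2]
    by (simp_all add: ell2_norm_sq_def)
  have "(\<Sum>\<^sub>\<infinity>x\<in>carrier G. \<bar>?p (x \<otimes> inv g) - ?p x\<bar>)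
      \<le> 2 * (t * (\<Sum>\<^sub>\<infinity>x\<in>carrier G. ?p x) + (1 + 1 / t) * (\<Sum>\<^sub>\<infinity>x\<in>carrier G. ?r x))"
  proof (rule infsum_abs_increment_le[OF bij_betw_right_translation[OF g] _ ps(1) _ rs(1)])
    fix x assume x: "x \<in> carrier G"
    let ?w = "\<lambda>j. \<Sum>l\<in>{1..<sz i}. \<sigma> j l * V l x"
    have "?p (x \<otimes> inv g) = (\<Sum>j\<in>{1..<sz i}. (cmod (?w j + E j x))\<^sup>2)"
      by (intro sum.cong refl) (simp add: E_def V_def X(4)[OF x])
    also have "\<dots> \<le> (\<Sum>j\<in>{1..<sz i}. (1 + t) * (cmod (?w j))\<^sup>2 + (1 + 1 / t) * (cmod (E j x))\<^sup>2)"
      by (intro sum_mono cmod_add_sq_le[OF t])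
    also have "\<dots> = (1 + t) * (\<Sum>j\<in>{1..<sz i}. (cmod (?w j))\<^sup>2) + (1 + 1 / t) * ?r x"
      by (simp only: sum.distrib sum_distrib_left)
    \<comment> \<open>The scalar contraction is applied to the finite vector of values
      \<open>V l x\<close> at the fixed point \<open>x\<close>.\<close>
    also have "\<dots> \<le> (1 + t) * ?p x + (1 + 1 / t) * ?r x"
      using diag_scalars_contractive[OF _ \<sigma>, of "\<lambda>l. V l x"] lift[OF g] t
      by (intro add_mono mult_left_mono) auto
    finally show "?p (x \<otimes> inv g) \<le> (1 + t) * ?p x + (1 + 1 / t) * ?r x" .
  qed (use t in \<open>auto simp: sum_nonneg\<close>)
  also have "\<dots> \<le> D"
  proof (rule D)
    show "(\<Sum>\<^sub>\<infinity>x\<in>carrier G. ?p x) \<le> state_sq \<rho> (\<mu> i a)"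
      using QV ell2_norm_sq_nonneg[of G "V 0"] ps(2) by linarith
    show "(\<Sum>\<^sub>\<infinity>x\<in>carrier G. ?r x) \<le> R"
      using QE ell2_norm_sq_nonneg[of G "E 0"] rs(2) by linarith
  qed
  finally show "(\<Sum>\<^sub>\<infinity>x\<in>carrier G. \<bar>?p (x \<otimes> inv g) - ?p x\<bar>) \<le> D" .
qed

text \<open>The left side splits exactly into the mass of the corner density off \<one> and the mass
  of the remaining densities, because the corner vector has the value
  \<open>\<rho> (\<mu> i a)\<close> at \<one>. Each gap bounds one of the two masses.\<close>

lemma spectral_gap_matrix:
  assumes gap1: "gap_on (carrier G - {\<one>}) K1 (\<lambda>g x. inv g \<otimes> x \<otimes> g) \<delta>1" and d1: "0 < \<delta>1"
    and gap2: "gap_on (carrier G) K2 (\<lambda>g x. x \<otimes> inv g) \<delta>2" and d2: "0 < \<delta>2"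
    and K: "K1 \<subseteq> carrier G" "K2 \<subseteq> carrier G"
    and a: "a \<in> carrier_mat (sz i) (sz i)" and t: "0 < t" and R0: "0 \<le> R"
    and R: "\<And>g. g \<in> K1 \<union> K2 \<Longrightarrow> state_sq \<rho> (\<mu> i a * \<iota> (lft g) - \<iota> (lft g) * \<mu> i a) \<le> R"
  shows "state_sq \<rho> (\<mu> i a) - (cmod (\<rho> (\<mu> i a)))\<^sup>2
    \<le> (1 / \<delta>1 + 1 / \<delta>2) * (2 * (t * state_sq \<rho> (\<mu> i a) + (1 + 1 / t) * R))"
proof -
  define V where "V j = vec_of (a $$ (j, 0))" for j
  define D where "D = 2 * (t * state_sq \<rho> (\<mu> i a) + (1 + 1 / t) * R)"
  have D0: "0 \<le> D"
    unfolding D_def using t R0 state_sq_nonneg[OF state] by (intro mult_nonneg_nonneg add_nonneg_nonneg) auto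
  have V2: "V j \<in> ell2 G" for j
    by (simp add: V_def vec_of_ell2)
  let ?X = "carrier G - {\<one>}"
  let ?p = "\<lambda>x. \<Sum>j\<in>{1..<sz i}. (cmod (V j x))\<^sup>2"
  have pX: "(\<lambda>x. (cmod (V 0 x))\<^sup>2) summable_on ?X"
    using ell2_summable[OF V2, of 0] by (rule summable_on_subset_banach) auto
  have ps: "?p summable_on carrier G" "(\<Sum>\<^sub>\<infinity>x\<in>carrier G. ?p x) = (\<Sum>j\<in>{1..<sz i}. ell2_norm_sq G (V j))"
    using infsum_sum_finite[of "{1..<sz i}" "\<lambda>j x. (cmod (V j x))\<^sup>2" "carrier G"] ell2_summable[OF V2]
    by (simp_all add: ell2_norm_sq_def)
  have "\<delta>1 * (\<Sum>\<^sub>\<infinity>x\<in>?X. (cmod (V 0 x))\<^sup>2) \<le> D"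
  proof (rule gap1[unfolded gap_on_def, rule_format, OF _ pX D0])
    fix g assume "g \<in> K1"
    then show "(\<Sum>\<^sub>\<infinity>x\<in>?X. \<bar>(cmod (V 0 (inv g \<otimes> x \<otimes> g)))\<^sup>2 - (cmod (V 0 x))\<^sup>2\<bar>) \<le> D"
      unfolding V_def D_def using K by (intro commutator_increments(1)[OF a _ t R]) auto
  qed simp
  then have b1: "(\<Sum>\<^sub>\<infinity>x\<in>?X. (cmod (V 0 x))\<^sup>2) \<le> 1 / \<delta>1 * D"
    using d1 by (simp add: field_simps)
  have "\<delta>2 * (\<Sum>\<^sub>\<infinity>x\<in>carrier G. ?p x) \<le> D"
  proof (rule gap2[unfolded gap_on_def, rule_format, OF _ ps(1) D0])
    fix g assume "g \<in> K2"
    then show "(\<Sum>\<^sub>\<infinity>x\<in>carrier G. \<bar>?p (x \<otimes> inv g) - ?p x\<bar>) \<le> D"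
      unfolding V_def D_def using K by (intro commutator_increments(2)[OF a _ t R]) auto
  qed (simp add: sum_nonneg)
  then have b2: "(\<Sum>\<^sub>\<infinity>x\<in>carrier G. ?p x) \<le> 1 / \<delta>2 * D"
    using d2 by (simp add: field_simps)
  have "ell2_norm_sq G (V 0) = (\<Sum>\<^sub>\<infinity>x\<in>{\<one>} \<union> ?X. (cmod (V 0 x))\<^sup>2)"
    unfolding ell2_norm_sq_def by (rule arg_cong[where f = "infsum _"]) auto
  also have "\<dots> = (\<Sum>\<^sub>\<infinity>x\<in>{\<one>}. (cmod (V 0 x))\<^sup>2) + (\<Sum>\<^sub>\<infinity>x\<in>?X. (cmod (V 0 x))\<^sup>2)"
    by (rule infsum_Un_disjoint[OF _ pX]) auto
  finally have V0: "ell2_norm_sq G (V 0) = (cmod (\<rho> (\<mu> i a)))\<^sup>2 + (\<Sum>\<^sub>\<infinity>x\<in>?X. (cmod (V 0 x))\<^sup>2)"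
    by (simp add: rho_mu[OF a] V_def)
  have "state_sq \<rho> (\<mu> i a) = ell2_norm_sq G (V 0) + (\<Sum>\<^sub>\<infinity>x\<in>carrier G. ?p x)"
    using state_sq_mu[OF a] unfolding ps(2) by (simp add: V_def sum_lessThan_split_first[OF dad_size_pos])
  then have "state_sq \<rho> (\<mu> i a) - (cmod (\<rho> (\<mu> i a)))\<^sup>2 \<le> 1 / \<delta>1 * D + 1 / \<delta>2 * D"
    using V0 b1 b2 by linarith
  then show ?thesis
    unfolding D_def distrib_right .
qed

text \<open>The strict bound by \<open>R\<close> is an open condition, so for the finitely many
  \<open>g\<close> it holds at late terms of a sequence of matrices tending to \<open>y\<close>. The
  conclusion then passes to the limit by continuity of both sides.\<close>

lemma spectral_gap:
  assumes gap1: "gap_on (carrier G - {\<one>}) K1 (\<lambda>g x. inv g \<otimes> x \<otimes> g) \<delta>1" and d1: "0 < \<delta>1"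
    and gap2: "gap_on (carrier G) K2 (\<lambda>g x. x \<otimes> inv g) \<delta>2" and d2: "0 < \<delta>2"
    and K: "K1 \<subseteq> carrier G" "K2 \<subseteq> carrier G" "finite K1" "finite K2"
    and t: "0 < t" and R0: "0 \<le> R"
    and R: "\<And>g. g \<in> K1 \<union> K2 \<Longrightarrow> state_sq \<rho> (y * \<iota> (lft g) - \<iota> (lft g) * y) < R"
  shows "state_sq \<rho> y - (cmod (\<rho> y))\<^sup>2 \<le> (1 / \<delta>1 + 1 / \<delta>2) * (2 * (t * state_sq \<rho> y + (1 + 1 / t) * R))"
proof -
  have "y \<in> closure (\<Union>i. \<mu> i ` carrier_mat (sz i) (sz i))"
    using mu_dense by simp
  then obtain f where f: "\<And>m. f m \<in> (\<Union>i. \<mu> i ` carrier_mat (sz i) (sz i))" and lim: "f \<longlonglongrightarrow> y"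
    unfolding closure_sequential by blast
  have sq: "(\<lambda>m. state_sq \<rho> (f m)) \<longlonglongrightarrow> state_sq \<rho> y"
    by (rule tendsto_state_sq[OF state lim])
  have rl: "(\<lambda>m. \<rho> (f m)) \<longlonglongrightarrow> \<rho> y"
    by (rule bounded_linear.tendsto[OF bounded_linear_state[OF state] lim])
  have "eventually (\<lambda>m. state_sq \<rho> (f m * \<iota> (lft g) - \<iota> (lft g) * f m) < R) sequentially" if "g \<in> K1 \<union> K2" for g
    by (rule order_tendstoD(2)[OF tendsto_state_sq[OF state] R[OF that]]) (intro tendsto_intros lim)
  then have "eventually (\<lambda>m. \<forall>g\<in>K1 \<union> K2. state_sq \<rho> (f m * \<iota> (lft g) - \<iota> (lft g) * f m) < R) sequentially"
    using K by (intro eventually_ball_finite) auto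
  then have "eventually (\<lambda>m. state_sq \<rho> (f m) - (cmod (\<rho> (f m)))\<^sup>2
      \<le> (1 / \<delta>1 + 1 / \<delta>2) * (2 * (t * state_sq \<rho> (f m) + (1 + 1 / t) * R))) sequentially"
  proof eventually_elim
    case (elim m)
    obtain i a where a: "a \<in> carrier_mat (sz i) (sz i)" and fm: "f m = \<mu> i a"
      using f[of m] by blast
    show ?case
      unfolding fm using elim unfolding fm
      by (intro spectral_gap_matrix[OF gap1 d1 gap2 d2 K(1,2) a t R0]) (auto intro: less_imp_le)
  qed
  then show ?thesis
    by (rule tendsto_le[OF sequentially_bot, rotated 2]) (intro tendsto_intros sq rl)+
qed

lemma almost_commuting_unitary:
  assumes "countable (carrier G)" "\<not> inner_amenable G" "carrier G \<noteq> {\<one>}" and \<epsilon>: "0 < (\<epsilon>::real)"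
  shows "\<exists>\<delta>>0. \<exists>K. finite K \<and> K \<subseteq> carrier G \<and>
    (\<forall>u. is_unitary u \<longrightarrow> (\<forall>g\<in>K. sharp_norm \<rho> (u * \<iota> (lft g) - \<iota> (lft g) * u) < \<delta>) \<longrightarrow> cmod (\<rho> u) > 1 - \<epsilon>)"
proof -
  obtain K1 and \<delta>1 :: real where K1: "finite K1" "K1 \<subseteq> carrier G" "\<delta>1 > 0"
    "gap_on (carrier G - {\<one>}) K1 (\<lambda>g x. inv g \<otimes> x \<otimes> g) \<delta>1"
    using conjugation_gap[OF assms(1,2)] by blast
  obtain K2 and \<delta>2 :: real where K2: "finite K2" "K2 \<subseteq> carrier G" "\<delta>2 > 0"
    "gap_on (carrier G) K2 (\<lambda>g x. x \<otimes> inv g) \<delta>2"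
    using right_translation_gap[OF assms(1-3)] by blast
  define C where "C = 1 / \<delta>1 + 1 / \<delta>2"
  have C: "C > 0" using K1(3) K2(3) by (simp add: C_def add_pos_pos)
  \<comment> \<open>\<open>t\<close> and \<open>R\<close> are chosen so that the two error terms
    contribute \<open>\<epsilon> / 4\<close> each; \<open>R\<close> comes second, as its factor
    \<open>1 + 1 / t\<close> depends on \<open>t\<close>.\<close>
  define t where "t = \<epsilon> / (8 * C)"
  have t: "t > 0" using C \<epsilon> by (simp add: t_def)
  define R where "R = \<epsilon> / (8 * C * (1 + 1 / t))"
  have R: "R > 0" using C \<epsilon> t by (simp add: R_def add_pos_pos)
  have s: "1 + 1 / t > 0" using t by (simp add: add_pos_pos)
  have small: "C * (2 * (t * 1 + (1 + 1 / t) * R)) = \<epsilon> / 2"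
  proof -
    have "C * t = \<epsilon> / 8" "C * ((1 + 1 / t) * R) = \<epsilon> / 8"
      using C s by (simp_all add: t_def R_def)
    moreover have "C * (2 * (t * 1 + (1 + 1 / t) * R)) = 2 * (C * t) + 2 * (C * ((1 + 1 / t) * R))"
      by (simp only: distrib_left mult_1_right mult.left_commute[of C])
    ultimately show ?thesis by simp
  qed
  show ?thesis
  \<comment> \<open>The value \<open>sqrt (R / 2)\<close> compensates the factor 2 in the bound of
    \<open>state_sq\<close> by the square of \<open>sharp_norm\<close>.\<close>
  proof (intro exI[of _ "sqrt (R / 2)"] exI[of _ "K1 \<union> K2"] conjI allI impI)
    fix u :: 'a
    assume u: "is_unitary u" and close: "\<forall>g\<in>K1 \<union> K2. sharp_norm \<rho> (u * \<iota> (lft g) - \<iota> (lft g) * u) < sqrt (R / 2)"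
    have su: "state_sq \<rho> u = 1"
      using u is_stateD(5)[OF state] by (simp add: state_sq_def is_unitary_def)
    have "state_sq \<rho> u - (cmod (\<rho> u))\<^sup>2 \<le> C * (2 * (t * state_sq \<rho> u + (1 + 1 / t) * R))"
      unfolding C_def
    proof (rule spectral_gap[OF K1(4,3) K2(4,3) K1(2) K2(2) K1(1) K2(1) t less_imp_le[OF R]])
      fix g assume "g \<in> K1 \<union> K2"
      then have "sharp_norm \<rho> (u * \<iota> (lft g) - \<iota> (lft g) * u) < sqrt (R / 2)" using close by blast
      moreover have "0 \<le> sharp_norm \<rho> (u * \<iota> (lft g) - \<iota> (lft g) * u)"
        by (simp add: sharp_norm_eq[OF state] state_sq_nonneg[OF state])
      ultimately have "(sharp_norm \<rho> (u * \<iota> (lft g) - \<iota> (lft g) * u))\<^sup>2 < (sqrt (R / 2))\<^sup>2"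
        by (intro power_strict_mono) auto
      then show "state_sq \<rho> (u * \<iota> (lft g) - \<iota> (lft g) * u) < R"
        using state_sq_le_sharp_norm[OF state, of "u * \<iota> (lft g) - \<iota> (lft g) * u"] R by simp
    qed
    then have "1 - (cmod (\<rho> u))\<^sup>2 \<le> \<epsilon> / 2"
      unfolding su small .
    moreover have "cmod (\<rho> u) \<le> 1"
    proof -
      have "(norm u)\<^sup>2 = 1"
        using cstar_identity[of u] u by (simp add: is_unitary_def)
      then show ?thesis
        using is_stateD(4)[OF state, of u] norm_ge_zero[of u] by (auto simp: power2_eq_1_iff)
    qed
    \<comment> \<open>As the modulus is at most 1, a lower bound for its square is one for the
      modulus itself, so no square root of \<open>\<epsilon>\<close> appears.\<close>
    then have "(cmod (\<rho> u))\<^sup>2 \<le> cmod (\<rho> u)"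
      by (simp add: power2_eq_square mult_left_le)
    ultimately show "cmod (\<rho> u) > 1 - \<epsilon>" using \<epsilon> by linarith
  qed (use K1 K2 R in auto)
qed

text \<open>A central sequence eventually meets the finitely many commutation conditions belonging
  to the value 1/2, which keeps \<open>cmod (\<rho> (u i))\<close> above 1/2.\<close>

lemma no_property_Gamma:
  assumes "countable (carrier G)" "\<not> inner_amenable G" "carrier G \<noteq> {\<one>}"
  shows "\<not> property_Gamma \<rho>"
proof
  assume "property_Gamma \<rho>"
  then obtain u where u: "\<And>i. is_unitary (u i)" "\<And>a. (\<lambda>i. norm (u i * a - a * u i)) \<longlonglongrightarrow> 0"
    "(\<lambda>i. cmod (\<rho> (u i))) \<longlonglongrightarrow> 0"
    unfolding property_Gamma_def by blast
  obtain \<delta> K where \<delta>: "\<delta> > 0" and K: "finite K" "K \<subseteq> carrier G"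
    and gap: "\<And>u. is_unitary u \<Longrightarrow> (\<forall>g\<in>K. sharp_norm \<rho> (u * \<iota> (lft g) - \<iota> (lft g) * u) < \<delta>) \<Longrightarrow>
      cmod (\<rho> u) > 1 - 1 / 2"
    using almost_commuting_unitary[OF assms, of "1 / 2"] by auto
  have "eventually (\<lambda>i. \<forall>g\<in>K. norm (u i * \<iota> (lft g) - \<iota> (lft g) * u i) < \<delta>) sequentially"
    using K(1) order_tendstoD(2)[OF u(2) \<delta>] by (intro eventually_ball_finite) auto
  moreover have "eventually (\<lambda>i. cmod (\<rho> (u i)) < 1 / 2) sequentially"
    by (rule order_tendstoD(2)[OF u(3)]) simp
  ultimately have "eventually (\<lambda>i. False) sequentially"
  proof eventually_elim
    case (elim i)
    have "\<forall>g\<in>K. sharp_norm \<rho> (u i * \<iota> (lft g) - \<iota> (lft g) * u i) < \<delta>"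
      using elim(1) sharp_norm_le_norm[OF state] order.strict_trans1 by blast
    then show False using gap[OF u(1)] elim(2) by fastforce
  qed
  then show False by simp
qed

end

theorem proposition2p15:
  fixes G :: "('g, 'b) monoid_scheme"
    and \<theta> :: "'d::cstar_algebra \<Rightarrow> 'g op"
    and n :: "nat \<Rightarrow> nat"
    and \<pi> :: "nat \<Rightarrow> 'd \<Rightarrow> complex mat"
    and \<mu> :: "nat \<Rightarrow> 'd mat \<Rightarrow> 'a::cstar_algebra"
    and \<rho> :: "'a \<Rightarrow> complex"
    and lft :: "'g \<Rightarrow> 'd"
  assumes "group G" and "countable (carrier G)" and "carrier G \<noteq> {\<one>\<^bsub>G\<^esub>}"
    and "\<not> inner_amenable G"
    and "separable_algebra TYPE('d)" and "RFD TYPE('d)"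
    and "surj_star_hom_reduced G \<theta>"
    and "dadarlat_limit n \<pi> \<mu>"
    and "is_rho_theta G \<theta> n \<mu> \<rho>"
    and "\<And>g. g \<in> carrier G \<Longrightarrow> norm (lft g) = 1 \<and> \<theta> (lft g) = left_reg G g"
  shows "(\<forall>\<epsilon>>0. \<exists>\<delta>>0. \<exists>K. finite K \<and> K \<subseteq> carrier G \<and>
            (\<forall>u :: 'a. is_unitary u \<longrightarrow>
               (\<forall>g\<in>K. sharp_norm \<rho> (u * dad_embed \<mu> (lft g) - dad_embed \<mu> (lft g) * u) < \<delta>) \<longrightarrow>
               cmod (\<rho> u) > 1 - \<epsilon>)) \<and>
         (\<forall>a. sharp_norm \<rho> a \<le> norm a) \<and>
         \<not> property_Gamma \<rho>"
proof -
  interpret dadarlat_state G \<theta> n \<pi> \<mu> \<rho> lft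
    using assms by (intro dadarlat_state.intro dadarlat_state_axioms.intro)
  show ?thesis
    using almost_commuting_unitary[OF assms(2,4,3)] no_property_Gamma[OF assms(2,4,3)]
      sharp_norm_le_norm[OF state] by blast
qed

end
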